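(* Let $C\subset\mathbb{R}^3$ be the image of an embedded regular curve defined on a bounded closed interval, of length $l>0$ and with nowhere vanishing curvature, and let $\Gamma\subset\mathbb{R}^2$ be the image of an arc-length parametrized regular plane curve $\gamma:[-l/2,l/2]\to\mathbb{R}^2$ without self-intersections. Assume $\mathcal{P}_*(\Gamma,|C|)$ is non-empty. Then the number $n$ of distinct elements of $\mathcal{P}_*(\Gamma,|C|)$ (as germs of subsets of $\mathbb{R}^3$ along $C$) is $n=4$ if $\Gamma$ has no symmetries, and $n=2$ otherwise.
   Context: Orientation: $C$ carries an orientation; $-C$ is $C$ with the opposite orientation and $|C|$ the unoriented curve. Let $J=[-l/2,l/2]$ and $\mathbf c:J\to\mathbb R^3$ an arc-length parametrization of $C$ inducing its orientation. For a regular parametrization $\mathbf c_f$ of $C$ we use its curvature $\kappa_f$, torsion $\tau_f$ and Frenet frame $(\mathbf e,\mathbf n,\mathbf b)$. Developable strips: a developable strip along $C$ is the germ along $C$ of a $C^\infty$ embedding $f(u,v)=f(u,0)+v\,\xi_f(u)$ defined on a neighbourhood of $J_0\times\{0\}$ in $J_0\times\mathbb R$ ($J_0$ a closed interval) such that $\mathbf c_f(u):=f(u,0)$ parametrizes $C$, $\xi_f$ is a unit vector field, and the Gaussian curvature of $f$ vanishes identically. Write $\xi_f=\cos\beta_f\,\mathbf e+\sin\beta_f(\cos\alpha_f\,\mathbf n+\sin\alpha_f\,\mathbf b)$ with the Frenet frame of $\mathbf c_f$. $\mathcal D(C)$ is the set of developable strips along $C$ such that $\mathbf c_f$ induces the orientation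 of $C$ and $0<|\cos\alpha_f|<1$; one normalizes $0<|\alpha_f|<\pi/2$ (first angular function) and $0<\beta_f<\pi$ (second angular function); vanishing Gaussian curvature is equivalent to $\cot\beta_f=(\alpha_f'+|\mathbf c_f'|\tau_f)/(|\mathbf c_f'|\kappa_f\sin\alpha_f)$. The geodesic curvature function is $\mu_f:=\kappa_f\cos\alpha_f>0$. $f$ is admissible if $\mu_f(u)<\min_w\kappa_f(w)$ for all $u$; $\mathcal D_*(C)$ is the set of admissible strips, and $\mathcal D_*(|C|):=\mathcal D_*(C)\cup\mathcal D_*(-C)$. Normal forms: a normal form is a developable strip $F(s,v)$ defined near $J\times\{0\}$ such that $s\mapsto F(s,0)$ is an arc-length parametrization of $C$. A normal form is determined by this parametrization and its first angular function, and every smooth function with values in $(-\pi/2,\pi/2)\setminus\{0\}$ occurs. The dual $\check F$ of a normal form $F$ is the normal form with $\check F(s,0)=F(s,0)$ and first angular function $-\alpha_F$. Curved foldings: the origami map of a normal form $F$ is $\Phi_F(s,v)=F(s,v)$ for $v\ge 0$ and $\Phi_F(s,v)=\check F(s,v)$ for $v<0$. Two functions $\mu_1,\mu_2$ on $[-l/2,l/2]$ are equi-affine equivalent if $\mu_2(\sigma s+d)=\mu_1(s)$ for some $\sigma\in\{1,-1\}$, $d\in\mathbb R$. $\Gamma$ is a generator (crease pattern) of $F$ if the curvature function of $\gamma$ is equi-affine equivalent to $\mu_F$. $\mathcal P_*(\Gamma,|C|)$ is the set of germs along $C$ of the images $\Phi_F(J\times(-\epsilon,\epsilon))$, $F$ ranging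 over normal forms in $\mathcal D_*(|C|)$ having generator $\Gamma$; two such germs are equal if the images coincide for all sufficiently small $\epsilon>0$. Symmetry: a subset $A\subset\mathbb R^k$ ($k=2,3$) has a symmetry if $T(A)=A$ for some isometry $T$ of $\mathbb R^k$ other than the identity. *)

theory Defs
  imports "HOL-Analysis.Analysis" "HOL-Analysis.Cross3"
begin

definition Jint :: "real \<Rightarrow> real set" where
  "Jint l = {-l/2 .. l/2}"

definition Cinf_on :: "real set \<Rightarrow> (real \<Rightarrow> 'a::real_normed_vector) \<Rightarrow> bool" where
  "Cinf_on S f \<longleftrightarrow> (\<exists>D. D 0 = f \<and>
      (\<forall>k. \<forall>t\<in>S. (D k has_vector_derivative D (Suc k) t) (at t)))"

definition d1 :: "(real \<Rightarrow> 'a::real_normed_vector) \<Rightarrow> real \<Rightarrow> 'a" where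
  "d1 f s = vector_derivative f (at s)"

definition d2 :: "(real \<Rightarrow> 'a::real_normed_vector) \<Rightarrow> real \<Rightarrow> 'a" where
  "d2 f s = vector_derivative (\<lambda>t. vector_derivative f (at t)) (at s)"

text \<open>Frenet data of an arc-length parametrized space curve.\<close>
definition curv :: "(real \<Rightarrow> real^3) \<Rightarrow> real \<Rightarrow> real" where
  "curv c s = norm (d2 c s)"

definition tang :: "(real \<Rightarrow> real^3) \<Rightarrow> real \<Rightarrow> real^3" where
  "tang c s = d1 c s"

definition pnormal :: "(real \<Rightarrow> real^3) \<Rightarrow> real \<Rightarrow> real^3" where
  "pnormal c s = (1 / curv c s) *\<^sub>R d2 c s"

definition binormal :: "(real \<Rightarrow> real^3) \<Rightarrow> real \<Rightarrow> real^3" where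
  "binormal c s = cross3 (tang c s) (pnormal c s)"

text \<open>Curvature function of an arc-length parametrized plane curve.\<close>
definition plane_curv :: "(real \<Rightarrow> real^2) \<Rightarrow> real \<Rightarrow> real" where
  "plane_curv g s = norm (d2 g s)"

definition pu :: "(real \<times> real \<Rightarrow> real^3) \<Rightarrow> real \<times> real \<Rightarrow> real^3" where
  "pu F p = vector_derivative (\<lambda>t. F (t, snd p)) (at (fst p))"

definition pv :: "(real \<times> real \<Rightarrow> real^3) \<Rightarrow> real \<times> real \<Rightarrow> real^3" where
  "pv F p = vector_derivative (\<lambda>t. F (fst p, t)) (at (snd p))"

definition unit_normal :: "(real \<times> real \<Rightarrow> real^3) \<Rightarrow> real \<times> real \<Rightarrow> real^3" where
  "unit_normal F p = (1 / norm (cross3 (pu F p) (pv F p))) *\<^sub>R cross3 (pu F p) (pv F p)"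

definition gauss_curv :: "(real \<times> real \<Rightarrow> real^3) \<Rightarrow> real \<times> real \<Rightarrow> real" where
  "gauss_curv F p =
     (let E = pu F p \<bullet> pu F p; FF = pu F p \<bullet> pv F p; G = pv F p \<bullet> pv F p;
          \<nu> = unit_normal F p;
          L = pu (pu F) p \<bullet> \<nu>; M = pv (pu F) p \<bullet> \<nu>; N = pv (pv F) p \<bullet> \<nu>
      in (L * N - M ^ 2) / (E * G - FF ^ 2))"

definition embedding_on :: "(real \<times> real) set \<Rightarrow> (real \<times> real \<Rightarrow> real^3) \<Rightarrow> bool" where
  "embedding_on U F \<longleftrightarrow> inj_on F U \<and> continuous_on U F \<and>
      (\<forall>p\<in>U. cross3 (pu F p) (pv F p) \<noteq> 0) \<and> continuous_on (F ` U) (inv_into U F)"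

definition base :: "(real \<times> real \<Rightarrow> real^3) \<Rightarrow> real \<Rightarrow> real^3" where
  "base F s = F (s, 0)"

definition rul :: "(real \<times> real \<Rightarrow> real^3) \<Rightarrow> real \<Rightarrow> real^3" where
  "rul F s = vector_derivative (\<lambda>v. F (s, v)) (at 0)"

definition normal_form :: "real \<Rightarrow> (real^3) set \<Rightarrow> (real \<times> real \<Rightarrow> real^3) \<Rightarrow> bool" where
  "normal_form l C F \<longleftrightarrow>
     (\<exists>I \<delta>. open I \<and> Jint l \<subseteq> I \<and> \<delta> > 0 \<and>
        Cinf_on I (base F) \<and> Cinf_on I (rul F) \<and>
        (\<forall>s\<in>I. \<forall>v. \<bar>v\<bar> < \<delta> \<longrightarrow> F (s, v) = base F s + v *\<^sub>R rul F s) \<and>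
        (\<forall>s\<in>I. norm (rul F s) = 1) \<and>
        embedding_on (I \<times> {-\<delta><..<\<delta>}) F \<and>
        (\<forall>p\<in>I \<times> {-\<delta><..<\<delta>}. gauss_curv F p = 0)) \<and>
     base F ` Jint l = C \<and> (\<forall>s\<in>Jint l. norm (d1 (base F) s) = 1)"

text \<open>First angular function alpha_F (valid under the normalization xi.n > 0, where
  xi = cos beta e + sin beta (cos alpha n + sin alpha b) with 0 < beta < pi).\<close>
definition angle1 :: "(real \<times> real \<Rightarrow> real^3) \<Rightarrow> real \<Rightarrow> real" where
  "angle1 F s = arctan ((rul F s \<bullet> binormal (base F) s) / (rul F s \<bullet> pnormal (base F) s))"

text \<open>Normalization |alpha_F| < pi/2 (with 0 < beta_F < pi): xi . n > 0.\<close>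
definition normalized :: "real \<Rightarrow> (real \<times> real \<Rightarrow> real^3) \<Rightarrow> bool" where
  "normalized l F \<longleftrightarrow> (\<forall>s\<in>Jint l. rul F s \<bullet> pnormal (base F) s > 0)"

definition mu :: "(real \<times> real \<Rightarrow> real^3) \<Rightarrow> real \<Rightarrow> real" where
  "mu F s = curv (base F) s * cos (angle1 F s)"

text \<open>Membership in D_*(|C|) = D_*(C) \<union> D_*(-C) for a normal form
  (orientation of C or -C is automatic for an arc-length parametrization of C).\<close>
definition in_Dstar :: "real \<Rightarrow> (real \<times> real \<Rightarrow> real^3) \<Rightarrow> bool" where
  "in_Dstar l F \<longleftrightarrow> normalized l F \<and>
     (\<forall>s\<in>Jint l. 0 < \<bar>cos (angle1 F s)\<bar> \<and> \<bar>cos (angle1 F s)\<bar> < 1) \<and>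
     (\<forall>s\<in>Jint l. mu F s < (INF w\<in>Jint l. curv (base F) w))"

definition is_dual :: "real \<Rightarrow> (real^3) set \<Rightarrow> (real \<times> real \<Rightarrow> real^3) \<Rightarrow> (real \<times> real \<Rightarrow> real^3) \<Rightarrow> bool" where
  "is_dual l C F G \<longleftrightarrow> normal_form l C G \<and> normalized l G \<and>
     (\<forall>s\<in>Jint l. G (s, 0) = F (s, 0)) \<and>
     (\<forall>s\<in>Jint l. angle1 G s = - angle1 F s)"

definition equi_affine_equiv :: "real \<Rightarrow> (real \<Rightarrow> real) \<Rightarrow> (real \<Rightarrow> real) \<Rightarrow> bool" where
  "equi_affine_equiv l mu1 mu2 \<longleftrightarrow>
     (\<exists>\<sigma> d. \<sigma> \<in> {1, -1} \<and> (\<forall>s\<in>Jint l. \<sigma> * s + d \<in> Jint l \<and> mu2 (\<sigma> * s + d) = mu1 s))"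

definition generator :: "real \<Rightarrow> (real \<Rightarrow> real^2) \<Rightarrow> (real \<times> real \<Rightarrow> real^3) \<Rightarrow> bool" where
  "generator l \<gamma> F \<longleftrightarrow> equi_affine_equiv l (plane_curv \<gamma>) (mu F)"

definition origami_image :: "real \<Rightarrow> (real \<times> real \<Rightarrow> real^3) \<Rightarrow> (real \<times> real \<Rightarrow> real^3) \<Rightarrow> real \<Rightarrow> (real^3) set" where
  "origami_image l F G \<epsilon> =
     (\<lambda>(s, v). if v \<ge> 0 then F (s, v) else G (s, v)) ` (Jint l \<times> {-\<epsilon><..<\<epsilon>})"

definition germ :: "(real \<Rightarrow> 'a set) \<Rightarrow> (real \<Rightarrow> 'a set) set" where
  "germ A = {B. \<exists>\<epsilon>0>0. \<forall>\<epsilon>. 0 < \<epsilon> \<and> \<epsilon> < \<epsilon>0 \<longrightarrow> B \<epsilon> = A \<epsilon>}"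

definition Pstar :: "real \<Rightarrow> (real \<Rightarrow> real^2) \<Rightarrow> (real^3) set \<Rightarrow> (real \<Rightarrow> (real^3) set) set set" where
  "Pstar l \<gamma> C = {germ (origami_image l F G) | F G.
      normal_form l C F \<and> in_Dstar l F \<and> generator l \<gamma> F \<and> is_dual l C F G}"

definition has_symmetry :: "(real^2) set \<Rightarrow> bool" where
  "has_symmetry A \<longleftrightarrow> (\<exists>T. (\<forall>x y. dist (T x) (T y) = dist x y) \<and> T \<noteq> id \<and> T ` A = A)"

end

theory Submission
  imports Defs
begin

text \<open>Along an arc length parametrized crease \<open>c\<close>, the normal of a strip with first angular
  function \<open>\<alpha>\<close> is \<open>N = b - tan \<alpha> n\<close> up to scaling, and vanishing Gaussian curvature forces the ruling to be
  orthogonal to both \<open>N\<close> and \<open>N'\<close>. Hence a strip is determined by its crease and \<open>\<alpha>\<close>, and conversely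
  \<open>N \<times> N'\<close> provides a ruling for every prescribed \<open>\<alpha>\<close>. Reversing the crease, one may assume that
  it is parametrized by \<open>c\<close>; then \<open>\<kappa> cos \<alpha>\<close> is the curvature of the crease pattern read forwards or
  backwards, and the sign of \<open>\<alpha>\<close> is constant, which leaves four candidates. The tangent half planes of a
  folding along the crease determine \<open>\<alpha>\<close>, so two candidates coincide only if the curvature of the
  crease pattern is an even function, which happens exactly if the crease pattern has a symmetry.\<close>

section \<open>Calculus of smooth functions of one variable\<close>

text \<open>Non-emptiness supplies two facts about \<gamma> that are not assumed: its curvature is
  positive, being some \<open>curv c s * cos \<alpha>\<close> with a positive cosine, and it stays
  below the infimum of \<open>curv c\<close>. Since that bound is uniform, the curvature m of the
  crease pattern satisfies m < \<open>curv c\<close> pointwise in either direction of reading. Hence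
  cos \<alpha> = m / \<open>curv c\<close> has a solution \<alpha> \<noteq> 0 of either sign, and
  one folding yields all four candidates.

  Angles are handled through tan \<alpha>, a quotient of inner products of the ruling with multiples
  of the frame vectors; continuity and smoothness then need no trigonometry.

  Each strip is smooth on an open neighbourhood of its own, whereas creases and angles are compared
  only on \<open>Jint l\<close>. Derivatives are therefore taken within the closed interval, where
  they are still unique.\<close>

fun times_diff_on :: "nat \<Rightarrow> real set \<Rightarrow> (real \<Rightarrow> 'a::real_normed_vector) \<Rightarrow> bool" where
  "times_diff_on 0 S f = True"
| "times_diff_on (Suc n) S f =
     (\<exists>f'. (\<forall>t\<in>S. (f has_vector_derivative f' t) (at t)) \<and> times_diff_on n S f')"

lemma times_diff_on_SucD: "times_diff_on (Suc n) S f \<Longrightarrow> times_diff_on n S f"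
  by (induction n arbitrary: f) auto

lemma times_diff_on_cong:
  assumes "open S" "times_diff_on n S f" "\<And>t. t \<in> S \<Longrightarrow> f t = g t"
  shows "times_diff_on n S g"
  using assms by (cases n) (auto intro: has_vector_derivative_transform_within_open)

lemma Cinf_on_imp_times_diff_on:
  assumes "Cinf_on S f"
  shows "times_diff_on n S f"
proof -
  obtain D where D: "D 0 = f" "\<And>k t. t \<in> S \<Longrightarrow> (D k has_vector_derivative D (Suc k) t) (at t)"
    using assms unfolding Cinf_on_def by auto
  have "times_diff_on n S (D k)" for k
    by (induction n arbitrary: k) (use D(2) in auto)
  then show ?thesis using D(1) by metis
qed

lemma times_diff_on_d1:
  assumes "open S" "times_diff_on (Suc n) S f"
  shows "times_diff_on n S (d1 f)" and "t \<in> S \<Longrightarrow> (f has_vector_derivative d1 f t) (at t)"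
proof -
  obtain f' where f': "\<And>t. t \<in> S \<Longrightarrow> (f has_vector_derivative f' t) (at t)" "times_diff_on n S f'"
    using assms(2) by auto
  have eq: "f' t = d1 f t" if "t \<in> S" for t
    using f'(1)[OF that] by (simp add: d1_def vector_derivative_at)
  show "times_diff_on n S (d1 f)"
    using times_diff_on_cong[OF assms(1) f'(2) eq] .
  show "t \<in> S \<Longrightarrow> (f has_vector_derivative d1 f t) (at t)"
    using f'(1) eq by metis
qed

text \<open>Closure of \<open>Cinf_on\<close> under products or inverses would require formulas for
  all derivatives at once; for a finite order each rule is an induction on that order. For the way
  back the iterates of \<open>d1\<close> serve as the sequence of derivatives.\<close>

lemma Cinf_on_iff:
  assumes "open S"
  shows "Cinf_on S f \<longleftrightarrow> (\<forall>n. times_diff_on n S f)"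
proof
  assume "\<forall>n. times_diff_on n S f"
  define D where "D k = (d1 ^^ k) f" for k
  have "\<forall>n. times_diff_on n S (D k)" for k
  proof (induction k)
    case (Suc k)
    then show ?case
      using times_diff_on_d1(1)[OF assms, of _ "D k"] by (simp add: D_def del: times_diff_on.simps)
  qed (simp add: D_def \<open>\<forall>n. times_diff_on n S f\<close>)
  then have "(D k has_vector_derivative D (Suc k) t) (at t)" if "t \<in> S" for k t
    using times_diff_on_d1(2)[OF assms, of _ "D k"] that by (simp add: D_def del: times_diff_on.simps)
  then show "Cinf_on S f"
    unfolding Cinf_on_def by (intro exI[of _ D]) (auto simp: D_def)
qed (auto intro: Cinf_on_imp_times_diff_on)

lemma Cinf_on_d1:
  assumes "open S" "Cinf_on S f"
  shows "Cinf_on S (d1 f)" and "t \<in> S \<Longrightarrow> (f has_vector_derivative d1 f t) (at t)"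
  using assms times_diff_on_d1[OF assms(1), of _ f] by (simp_all add: Cinf_on_iff del: times_diff_on.simps)

lemma d2_eq_d1_d1: "d2 f = d1 (d1 f)"
  unfolding d2_def[abs_def] d1_def[abs_def] ..

lemma Cinf_on_d2:
  assumes "open S" "Cinf_on S f"
  shows "Cinf_on S (d2 f)" and "t \<in> S \<Longrightarrow> (d1 f has_vector_derivative d2 f t) (at t)"
  using Cinf_on_d1[OF assms(1) Cinf_on_d1(1)[OF assms]] by (simp_all add: d2_eq_d1_d1)

lemma Cinf_on_subset: "Cinf_on S f \<Longrightarrow> T \<subseteq> S \<Longrightarrow> Cinf_on T f"
  unfolding Cinf_on_def by blast

lemma Cinf_on_continuous: "Cinf_on S f \<Longrightarrow> continuous_on S f"
  unfolding Cinf_on_def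
  by (metis continuous_at_imp_continuous_on has_vector_derivative_continuous)

section \<open>Closure properties of smooth functions\<close>

lemma times_diff_on_const: "times_diff_on n S (\<lambda>t. a)"
  by (induction n arbitrary: a) (auto intro!: exI[of _ "\<lambda>_. 0"])

lemma times_diff_on_add:
  "times_diff_on n S f \<Longrightarrow> times_diff_on n S g \<Longrightarrow> times_diff_on n S (\<lambda>t. f t + g t)"
proof (induction n arbitrary: f g)
  case (Suc n)
  then obtain f' g' where fg:
    "\<And>t. t \<in> S \<Longrightarrow> (f has_vector_derivative f' t) (at t)" "times_diff_on n S f'"
    "\<And>t. t \<in> S \<Longrightarrow> (g has_vector_derivative g' t) (at t)" "times_diff_on n S g'"
    unfolding times_diff_on.simps by metis
  then show ?case
    using Suc.IH by (auto intro!: exI[of _ "\<lambda>t. f' t + g' t"] derivative_intros)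
qed simp

lemma (in bounded_bilinear) times_diff_on_prod:
  "times_diff_on n S f \<Longrightarrow> times_diff_on n S g \<Longrightarrow> times_diff_on n S (\<lambda>t. prod (f t) (g t))"
proof (induction n arbitrary: f g)
  case (Suc n)
  then obtain f' g' where
    f: "\<And>t. t \<in> S \<Longrightarrow> (f has_vector_derivative f' t) (at t)" "times_diff_on n S f'" and
    g: "\<And>t. t \<in> S \<Longrightarrow> (g has_vector_derivative g' t) (at t)" "times_diff_on n S g'"
    unfolding times_diff_on.simps by metis
  have "times_diff_on n S f" "times_diff_on n S g"
    using Suc.prems times_diff_on_SucD by blast+
  with f g Suc.IH have "times_diff_on n S (\<lambda>t. prod (f t) (g' t) + prod (f' t) (g t))"
    by (auto intro: times_diff_on_add)
  then show ?case
    using has_vector_derivative[OF f(1) g(1)] unfolding times_diff_on.simps by (intro exI conjI ballI)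
qed simp

text \<open>The derivative of 1/f is -f'/f^2, which contains 1/f itself; the induction hypothesis
  covers that factor one order lower. The same device serves the square root.\<close>

lemma times_diff_on_inverse:
  fixes f :: "real \<Rightarrow> real"
  assumes "\<And>t. t \<in> S \<Longrightarrow> f t \<noteq> 0"
  shows "times_diff_on n S f \<Longrightarrow> times_diff_on n S (\<lambda>t. inverse (f t))"
proof (induction n)
  case (Suc n)
  then obtain f' where
    f: "\<And>t. t \<in> S \<Longrightarrow> (f has_vector_derivative f' t) (at t)" "times_diff_on n S f'"
    by auto
  have IH: "times_diff_on n S (\<lambda>t. inverse (f t))"
    using Suc times_diff_on_SucD by blast
  have "times_diff_on n S (\<lambda>t. (-1) * ((inverse (f t) * f' t) * inverse (f t)))"
    by (intro bounded_bilinear.times_diff_on_prod[OF bounded_bilinear_mult] times_diff_on_const IH f)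
  moreover have "((\<lambda>t. inverse (f t)) has_vector_derivative (-1) * ((inverse (f t) * f' t) * inverse (f t))) (at t)"
    if "t \<in> S" for t
    using DERIV_inverse_fun[of f "f' t" t] f(1)[OF that] assms[OF that]
    by (simp add: has_real_derivative_iff_has_vector_derivative mult.commute mult.left_commute power2_eq_square)
  ultimately show ?case
    unfolding times_diff_on.simps by (intro exI conjI ballI)
qed simp

lemma times_diff_on_sqrt:
  assumes "\<And>t. t \<in> S \<Longrightarrow> f t > 0"
  shows "times_diff_on n S f \<Longrightarrow> times_diff_on n S (\<lambda>t. sqrt (f t))"
proof (induction n)
  case (Suc n)
  then obtain f' where
    f: "\<And>t. t \<in> S \<Longrightarrow> (f has_vector_derivative f' t) (at t)" "times_diff_on n S f'"
    by auto
  have IH: "times_diff_on n S (\<lambda>t. inverse (sqrt (f t)))"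
    using times_diff_on_inverse[of S "\<lambda>t. sqrt (f t)" n] Suc.IH times_diff_on_SucD[OF Suc.prems] assms
    by (metis less_irrefl real_sqrt_eq_zero_cancel_iff)
  have "times_diff_on n S (\<lambda>t. (inverse (sqrt (f t)) * (1/2)) * f' t)"
    by (intro bounded_bilinear.times_diff_on_prod[OF bounded_bilinear_mult] times_diff_on_const IH f)
  moreover have "((\<lambda>t. sqrt (f t)) has_vector_derivative (inverse (sqrt (f t)) * (1/2)) * f' t) (at t)"
    if "t \<in> S" for t
    using DERIV_chain2[where f = sqrt and g = f, OF DERIV_real_sqrt[OF assms[OF that]], of "f' t" UNIV] f(1)[OF that]
    by (simp add: has_real_derivative_iff_has_vector_derivative field_simps)
  ultimately show ?case
    unfolding times_diff_on.simps by (intro exI conjI ballI)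
qed simp

lemma has_vector_derivative_reflect:
  assumes "(f has_vector_derivative f') (at (- s))"
  shows "((\<lambda>s. f (- s)) has_vector_derivative - f') (at s within S)"
proof -
  have "(uminus has_vector_derivative -1) (at s)"
    by (auto intro!: derivative_eq_intros)
  from vector_diff_chain_at[OF this, of f f'] assms
  show ?thesis by (auto simp: o_def intro: has_vector_derivative_at_within)
qed

lemma times_diff_on_reflect:
  "times_diff_on n S f \<Longrightarrow> times_diff_on n (uminus ` S) (\<lambda>t. f (- t))"
proof (induction n arbitrary: f)
  case (Suc n)
  then obtain f' where
    f: "\<And>t. t \<in> S \<Longrightarrow> (f has_vector_derivative f' t) (at t)" "times_diff_on n S f'"
    by auto
  have "times_diff_on n (uminus ` S) (\<lambda>t. (-1) *\<^sub>R f' (- t))"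
    by (intro bounded_bilinear.times_diff_on_prod[OF bounded_bilinear_scaleR] times_diff_on_const Suc.IH f)
  moreover have "((\<lambda>t. f (- t)) has_vector_derivative (-1) *\<^sub>R f' (- t)) (at t)"
    if "t \<in> uminus ` S" for t
    using has_vector_derivative_reflect[of f "f' (- t)" t UNIV] f(1) that by auto
  ultimately show ?case
    unfolding times_diff_on.simps by (intro exI conjI ballI)
qed simp

context
  fixes S :: "real set"
  assumes S: "open S"
begin

lemma Cinf_on_const: "Cinf_on S (\<lambda>t. a)"
  by (simp add: Cinf_on_iff S times_diff_on_const)

lemma Cinf_on_add: "Cinf_on S f \<Longrightarrow> Cinf_on S g \<Longrightarrow> Cinf_on S (\<lambda>t. f t + g t)"
  by (simp add: Cinf_on_iff S times_diff_on_add)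

lemma Cinf_on_mult:
  fixes f g :: "real \<Rightarrow> real"
  shows "Cinf_on S f \<Longrightarrow> Cinf_on S g \<Longrightarrow> Cinf_on S (\<lambda>t. f t * g t)"
  by (simp add: Cinf_on_iff S bounded_bilinear.times_diff_on_prod[OF bounded_bilinear_mult])

lemma Cinf_on_scaleR: "Cinf_on S f \<Longrightarrow> Cinf_on S g \<Longrightarrow> Cinf_on S (\<lambda>t. f t *\<^sub>R g t)"
  by (simp add: Cinf_on_iff S bounded_bilinear.times_diff_on_prod[OF bounded_bilinear_scaleR])

lemma Cinf_on_inner: "Cinf_on S f \<Longrightarrow> Cinf_on S g \<Longrightarrow> Cinf_on S (\<lambda>t. f t \<bullet> g t)"
  by (simp add: Cinf_on_iff S bounded_bilinear.times_diff_on_prod[OF bounded_bilinear_inner])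

lemma Cinf_on_cross3: "Cinf_on S f \<Longrightarrow> Cinf_on S g \<Longrightarrow> Cinf_on S (\<lambda>t. cross3 (f t) (g t))"
  by (simp add: Cinf_on_iff S bounded_bilinear.times_diff_on_prod
      [OF bilinear_conv_bounded_bilinear[THEN iffD1, OF bilinear_cross]])

lemma Cinf_on_diff:
  fixes f g :: "real \<Rightarrow> 'a::real_normed_vector"
  shows "Cinf_on S f \<Longrightarrow> Cinf_on S g \<Longrightarrow> Cinf_on S (\<lambda>t. f t - g t)"
  using Cinf_on_add[OF _ Cinf_on_scaleR[OF Cinf_on_const[of "-1"]], of f g] by simp

lemma Cinf_on_inverse:
  fixes f :: "real \<Rightarrow> real"
  shows "Cinf_on S f \<Longrightarrow> (\<And>t. t \<in> S \<Longrightarrow> f t \<noteq> 0) \<Longrightarrow> Cinf_on S (\<lambda>t. inverse (f t))"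
  by (simp add: Cinf_on_iff S times_diff_on_inverse)

lemma Cinf_on_divide:
  fixes f g :: "real \<Rightarrow> real"
  shows "Cinf_on S f \<Longrightarrow> Cinf_on S g \<Longrightarrow> (\<And>t. t \<in> S \<Longrightarrow> g t \<noteq> 0) \<Longrightarrow> Cinf_on S (\<lambda>t. f t / g t)"
  using Cinf_on_mult[OF _ Cinf_on_inverse, of f g] by (simp add: divide_inverse)

lemma Cinf_on_sqrt: "Cinf_on S f \<Longrightarrow> (\<And>t. t \<in> S \<Longrightarrow> f t > 0) \<Longrightarrow> Cinf_on S (\<lambda>t. sqrt (f t))"
  by (simp add: Cinf_on_iff S times_diff_on_sqrt)

lemma Cinf_on_norm:
  fixes f :: "real \<Rightarrow> 'a::real_inner"
  shows "Cinf_on S f \<Longrightarrow> (\<And>t. t \<in> S \<Longrightarrow> f t \<noteq> 0) \<Longrightarrow> Cinf_on S (\<lambda>t. norm (f t))"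
  by (simp add: norm_eq_sqrt_inner Cinf_on_sqrt Cinf_on_inner)

lemma Cinf_on_reflect: "Cinf_on S f \<Longrightarrow> Cinf_on (uminus ` S) (\<lambda>t. f (- t))"
  using open_negations[OF S] by (simp add: Cinf_on_iff S times_diff_on_reflect)

end

section \<open>Developable ruled strips\<close>

text \<open>Since l > 0 the interval is nondegenerate, so even the one-sided derivatives at its
  endpoints are unique. This allows functions that agree only on \<open>Jint l\<close> to be
  compared, and identities valid only there to be differentiated.\<close>

lemma Jint_unique_derivative:
  assumes "l > 0" "s \<in> Jint l" "\<And>t. t \<in> Jint l \<Longrightarrow> f t = g t"
    and "(f has_vector_derivative D) (at s within Jint l)"
    and "(g has_vector_derivative E) (at s within Jint l)"
  shows "D = E"
proof -
  have "(g has_vector_derivative D) (at s within Jint l)"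
    using has_vector_derivative_transform[OF assms(2) _ assms(4), of g] assms(3) by simp
  then show ?thesis
    using vector_derivative_unique_within_closed_interval[of "-l/2" "l/2" s g D E] assms
    by (simp add: Jint_def)
qed

lemma d1_eq_on_Jint:
  assumes "l > 0" "open I1" "open I2" "Jint l \<subseteq> I1" "Jint l \<subseteq> I2" "Cinf_on I1 f" "Cinf_on I2 g"
    and "\<And>t. t \<in> Jint l \<Longrightarrow> f t = g t" and "s \<in> Jint l"
  shows "d1 f s = d1 g s"
proof (rule Jint_unique_derivative[OF assms(1,9,8)])
  show "(f has_vector_derivative d1 f s) (at s within Jint l)"
    using Cinf_on_d1(2)[OF assms(2,6)] assms(4,9) by (blast intro: has_vector_derivative_at_within)
  show "(g has_vector_derivative d1 g s) (at s within Jint l)"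
    using Cinf_on_d1(2)[OF assms(3,7)] assms(5,9) by (blast intro: has_vector_derivative_at_within)
qed

lemma d2_eq_on_Jint:
  assumes "l > 0" "open I1" "open I2" "Jint l \<subseteq> I1" "Jint l \<subseteq> I2" "Cinf_on I1 f" "Cinf_on I2 g"
    and "\<And>t. t \<in> Jint l \<Longrightarrow> f t = g t" and "s \<in> Jint l"
  shows "d2 f s = d2 g s"
  unfolding d2_eq_d1_d1
  by (rule d1_eq_on_Jint[OF assms(1-5) Cinf_on_d1(1)[OF assms(2,6)] Cinf_on_d1(1)[OF assms(3,7)]
        d1_eq_on_Jint[OF assms(1-8)] assms(9)])

lemma d1_orthogonal_d2:
  fixes c :: "real \<Rightarrow> 'a::real_inner"
  assumes "l > 0" "open I" "Jint l \<subseteq> I" "Cinf_on I c"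
    and "\<And>t. t \<in> Jint l \<Longrightarrow> norm (d1 c t) = 1" and "s \<in> Jint l"
  shows "d1 c s \<bullet> d2 c s = 0"
proof -
  have d: "(d1 c has_vector_derivative d2 c s) (at s within Jint l)"
    using assms Cinf_on_d2(2) by (blast intro: has_vector_derivative_at_within)
  have "d1 c s \<bullet> d2 c s + d2 c s \<bullet> d1 c s = 0"
    by (rule Jint_unique_derivative[OF assms(1,6), of "\<lambda>t. d1 c t \<bullet> d1 c t" "\<lambda>t. 1"],
        rule_tac [2] bounded_bilinear.has_vector_derivative[OF bounded_bilinear_inner d d])
       (auto simp: assms(5) simp flip: norm_eq_1)
  then show ?thesis by (simp add: inner_commute)
qed

section \<open>Ruled strips and their Gaussian curvature\<close>

definition ruled_on :: "real set \<Rightarrow> real \<Rightarrow> (real \<times> real \<Rightarrow> real^3) \<Rightarrow> bool" where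
  "ruled_on I \<delta> F \<longleftrightarrow> open I \<and> \<delta> > 0 \<and> Cinf_on I (base F) \<and> Cinf_on I (rul F) \<and>
     (\<forall>s\<in>I. \<forall>v. \<bar>v\<bar> < \<delta> \<longrightarrow> F (s, v) = base F s + v *\<^sub>R rul F s)"

context
  fixes I \<delta> F
  assumes ruled: "ruled_on I \<delta> F"
begin

lemma ruled_derivs:
  assumes "s \<in> I"
  shows "(base F has_vector_derivative d1 (base F) s) (at s)"
    and "(rul F has_vector_derivative d1 (rul F) s) (at s)"
  using ruled assms unfolding ruled_on_def by (blast intro: Cinf_on_d1(2))+

lemma ruled_pu:
  assumes "s \<in> I" "\<bar>v\<bar> < \<delta>"
  shows "pu F (s, v) = d1 (base F) s + v *\<^sub>R d1 (rul F) s"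
proof -
  have "((\<lambda>t. base F t + v *\<^sub>R rul F t) has_vector_derivative d1 (base F) s + v *\<^sub>R d1 (rul F) s) (at s)"
    by (auto intro!: derivative_eq_intros ruled_derivs assms)
  then have "((\<lambda>t. F (t, v)) has_vector_derivative d1 (base F) s + v *\<^sub>R d1 (rul F) s) (at s)"
    by (rule has_vector_derivative_transform_within_open[of _ _ _ I])
       (use ruled assms in \<open>auto simp: ruled_on_def\<close>)
  then show ?thesis
    by (simp add: pu_def vector_derivative_at)
qed

lemma ruled_pv:
  assumes "s \<in> I" "\<bar>v\<bar> < \<delta>"
  shows "pv F (s, v) = rul F s"
proof -
  have "((\<lambda>t. base F s + t *\<^sub>R rul F s) has_vector_derivative rul F s) (at v)"
    by (auto intro!: derivative_eq_intros)
  then have "((\<lambda>t. F (s, t)) has_vector_derivative rul F s) (at v)"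
    by (rule has_vector_derivative_transform_within_open[of _ _ _ "{-\<delta><..<\<delta>}"])
       (use ruled assms in \<open>auto simp: ruled_on_def\<close>)
  then show ?thesis
    by (simp add: pv_def vector_derivative_at)
qed

lemma ruled_pv_pu:
  assumes "s \<in> I" "\<bar>v\<bar> < \<delta>"
  shows "pv (pu F) (s, v) = d1 (rul F) s"
proof -
  have "((\<lambda>t. d1 (base F) s + t *\<^sub>R d1 (rul F) s) has_vector_derivative d1 (rul F) s) (at v)"
    by (auto intro!: derivative_eq_intros)
  then have "((\<lambda>t. pu F (s, t)) has_vector_derivative d1 (rul F) s) (at v)"
    by (rule has_vector_derivative_transform_within_open[of _ _ _ "{-\<delta><..<\<delta>}"])
       (use ruled_pu assms in auto)
  then show ?thesis
    by (simp add: pv_def[of "pu F"] vector_derivative_at)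
qed

lemma ruled_pv_pv:
  assumes "s \<in> I" "\<bar>v\<bar> < \<delta>"
  shows "pv (pv F) (s, v) = 0"
proof -
  have "((\<lambda>t. rul F s) has_vector_derivative 0) (at v)"
    by (auto intro!: derivative_eq_intros)
  then have "((\<lambda>t. pv F (s, t)) has_vector_derivative 0) (at v)"
    by (rule has_vector_derivative_transform_within_open[of _ _ _ "{-\<delta><..<\<delta>}"])
       (use ruled_pv assms in auto)
  then show ?thesis
    by (simp add: pv_def[of "pv F"] vector_derivative_at)
qed

text \<open>A ruled strip has F_vv = 0, so its curvature is -M^2 / (EG - F^2). In M the part of the
  normal that depends on v drops out, because \<xi>' is orthogonal to \<xi>' x \<xi>. The criterion
  is thus free of v: it can be read off along the crease and yet controls the whole strip.\<close>

lemma ruled_gauss_curv_eq_0_iff: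
  assumes "s \<in> I" "\<bar>v\<bar> < \<delta>" and nz: "cross3 (pu F (s, v)) (pv F (s, v)) \<noteq> 0"
  shows "gauss_curv F (s, v) = 0 \<longleftrightarrow> d1 (rul F) s \<bullet> cross3 (d1 (base F) s) (rul F s) = 0"
proof -
  define X where "X = cross3 (pu F (s, v)) (pv F (s, v))"
  have X: "X = cross3 (d1 (base F) s) (rul F s) + v *\<^sub>R cross3 (d1 (rul F) s) (rul F s)"
    by (simp add: X_def ruled_pu ruled_pv assms cross_add_left cross_mult_left)
  have M: "pv (pu F) (s, v) \<bullet> unit_normal F (s, v)
            = (d1 (rul F) s \<bullet> cross3 (d1 (base F) s) (rul F s)) / norm X"
    by (simp add: unit_normal_def X_def[symmetric] ruled_pv_pu assms)
       (simp add: X inner_add_right dot_cross_self)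
  have "(pu F (s, v) \<bullet> pu F (s, v)) * (pv F (s, v) \<bullet> pv F (s, v)) - (pu F (s, v) \<bullet> pv F (s, v))\<^sup>2
        = (norm X)\<^sup>2"
    using norm_cross_dot[of "pu F (s, v)" "pv F (s, v)"]
    by (simp add: X_def power_mult_distrib power2_norm_eq_inner)
  then have "gauss_curv F (s, v) = - ((pv (pu F) (s, v) \<bullet> unit_normal F (s, v))\<^sup>2) / (norm X)\<^sup>2"
    by (simp add: gauss_curv_def ruled_pv_pv assms)
  also have "\<dots> = 0 \<longleftrightarrow> d1 (rul F) s \<bullet> cross3 (d1 (base F) s) (rul F s) = 0"
    using nz unfolding M by (simp add: X_def)
  finally show ?thesis .
qed

end

text \<open>What later arguments retain of a given normal form: the embedding survives as
  injectivity of the crease and regularity along v = 0, flatness as the vanishing determinant of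
  \<xi>', c' and \<xi>.\<close>

definition strip_on :: "real \<Rightarrow> (real^3) set \<Rightarrow> (real \<times> real \<Rightarrow> real^3) \<Rightarrow> real set \<Rightarrow> real \<Rightarrow> bool" where
  "strip_on l C F I \<delta> \<longleftrightarrow> ruled_on I \<delta> F \<and> Jint l \<subseteq> I \<and> inj_on (base F) I \<and>
     (\<forall>s\<in>I. norm (rul F s) = 1 \<and> cross3 (d1 (base F) s) (rul F s) \<noteq> 0 \<and>
        d1 (rul F) s \<bullet> cross3 (d1 (base F) s) (rul F s) = 0) \<and>
     base F ` Jint l = C \<and> (\<forall>s\<in>Jint l. norm (d1 (base F) s) = 1)"

lemma strip_onD:
  assumes "strip_on l C F I \<delta>"
  shows "open I" "Jint l \<subseteq> I" "\<delta> > 0" "Cinf_on I (base F)" "Cinf_on I (rul F)"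
    and "s \<in> I \<Longrightarrow> \<bar>v\<bar> < \<delta> \<Longrightarrow> F (s, v) = base F s + v *\<^sub>R rul F s"
    and "inj_on (base F) I" "s \<in> I \<Longrightarrow> norm (rul F s) = 1"
    and "s \<in> I \<Longrightarrow> cross3 (d1 (base F) s) (rul F s) \<noteq> 0"
    and "s \<in> I \<Longrightarrow> d1 (rul F) s \<bullet> cross3 (d1 (base F) s) (rul F s) = 0"
    and "base F ` Jint l = C" "s \<in> Jint l \<Longrightarrow> norm (d1 (base F) s) = 1" "s \<in> Jint l \<Longrightarrow> s \<in> I"
  using assms unfolding strip_on_def ruled_on_def by blast+

lemma normal_form_strip_on:
  assumes "normal_form l C F"
  obtains I \<delta> where "strip_on l C F I \<delta>"
proof -
  obtain I \<delta> where r: "ruled_on I \<delta> F" "Jint l \<subseteq> I" "\<And>s. s \<in> I \<Longrightarrow> norm (rul F s) = 1"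
    and e: "embedding_on (I \<times> {-\<delta><..<\<delta>}) F" and g: "\<And>p. p \<in> I \<times> {-\<delta><..<\<delta>} \<Longrightarrow> gauss_curv F p = 0"
    using assms unfolding normal_form_def ruled_on_def by blast
  have \<delta>: "\<delta> > 0" using r by (simp add: ruled_on_def)
  have p: "(s, 0) \<in> I \<times> {-\<delta><..<\<delta>}" if "s \<in> I" for s
    using that \<delta> by simp
  have nz: "cross3 (pu F (s, 0)) (pv F (s, 0)) \<noteq> 0" if "s \<in> I" for s
    using e p[OF that] unfolding embedding_on_def by blast
  have "inj_on (base F) I"
    using e p unfolding embedding_on_def base_def inj_on_def by blast
  moreover have "cross3 (d1 (base F) s) (rul F s) \<noteq> 0" if "s \<in> I" for s
    using nz[OF that] ruled_pu[OF r(1) that, of 0] ruled_pv[OF r(1) that, of 0] \<delta> by simp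
  moreover have "d1 (rul F) s \<bullet> cross3 (d1 (base F) s) (rul F s) = 0" if "s \<in> I" for s
    using ruled_gauss_curv_eq_0_iff[OF r(1) that _ nz[OF that]] g[OF p[OF that]] \<delta> by simp
  ultimately have "strip_on l C F I \<delta>"
    using r assms unfolding strip_on_def normal_form_def by blast
  then show thesis by (rule that)
qed

text \<open>By Lagrange's identity u x (a x b) = 0; crossing once more with a x b gives the claim.
  This form avoids a division and so holds for dependent a and b as well.\<close>

lemma orthogonal_imp_parallel_cross:
  fixes u :: "real^3"
  assumes "u \<bullet> a = 0" "u \<bullet> b = 0"
  shows "(cross3 a b \<bullet> cross3 a b) *\<^sub>R u = (cross3 a b \<bullet> u) *\<^sub>R cross3 a b"
proof -
  have "cross3 u (cross3 a b) = 0"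
    using assms by (simp add: Lagrange inner_commute)
  then have "cross3 (cross3 a b) (cross3 u (cross3 a b)) = 0" by simp
  then show ?thesis by (simp only: Lagrange[of "cross3 a b" u "cross3 a b"]) simp
qed

text \<open>The vectors orthogonal to a and b form a line, which contains just two unit vectors, and
  m selects one of them. The intended a and b are the strip normal and its derivative, and m is
  c''.\<close>

lemma unit_orthogonal_unique:
  fixes u :: "real^3"
  assumes "u \<bullet> a = 0" "u \<bullet> b = 0" "w \<bullet> a = 0" "w \<bullet> b = 0" "cross3 a b \<noteq> 0"
    and "norm u = 1" "norm w = 1" "u \<bullet> m > 0" "w \<bullet> m > 0"
  shows "u = w"
proof -
  define X where "X = cross3 a b"
  have X: "X \<bullet> X > 0" using assms by (simp add: X_def)
  define k where "k = (X \<bullet> u) / (X \<bullet> X)"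
  define k' where "k' = (X \<bullet> w) / (X \<bullet> X)"
  have u: "u = k *\<^sub>R X" and w: "w = k' *\<^sub>R X"
    using arg_cong[OF orthogonal_imp_parallel_cross[of u a b], of "scaleR (inverse (X \<bullet> X))"]
      arg_cong[OF orthogonal_imp_parallel_cross[of w a b], of "scaleR (inverse (X \<bullet> X))"] assms(1-4) X
    by (simp_all add: k_def k'_def X_def[symmetric] divide_inverse mult.commute)
  have "\<bar>k\<bar> * norm X = \<bar>k'\<bar> * norm X"
    using assms(6,7) by (simp add: u w)
  then have "\<bar>k\<bar> = \<bar>k'\<bar>" using X by auto
  moreover have "k * k' > 0"
  proof -
    have "0 < (k * (X \<bullet> m)) * (k' * (X \<bullet> m))"
      using assms(8,9) by (simp add: u w)
    then have "0 < (k * k') * (X \<bullet> m)\<^sup>2" by (simp add: power2_eq_square mult_ac)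
    then show ?thesis by (simp add: zero_less_mult_iff)
  qed
  ultimately have "k = k'"
    by (auto simp: abs_if zero_less_mult_iff split: if_splits)
  then show ?thesis by (simp add: u w)
qed

section \<open>The first angular function and the strip normal\<close>

lemma tan_angle1:
  assumes "curv (base F) s \<noteq> 0"
  shows "tan (angle1 F s) = (rul F s \<bullet> cross3 (d1 (base F) s) (d2 (base F) s)) / (rul F s \<bullet> d2 (base F) s)"
  using assms
  by (simp add: angle1_def tan_arctan binormal_def pnormal_def tang_def cross_mult_right)

lemma angle1_bounds: "- (pi/2) < angle1 F s" "angle1 F s < pi/2"
  unfolding angle1_def by (rule arctan_lbound arctan_ubound)+

lemma angle1_eq_iff_tan: "angle1 F s = angle1 G s' \<longleftrightarrow> tan (angle1 F s) = tan (angle1 G s')"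
  by (simp add: angle1_def tan_arctan arctan_eq_iff)

lemma normalizedD:
  assumes "normalized l F" "s \<in> Jint l"
  shows "rul F s \<bullet> d2 (base F) s > 0"
  using assms by (simp add: normalized_def pnormal_def curv_def)
     (metis less_irrefl norm_ge_zero zero_less_divide_iff order_le_less_trans)

text \<open>Along a unit speed crease this is \<open>\<kappa> (b - tan \<alpha> n)\<close>, a normal of the strip.\<close>

definition strip_normal :: "(real \<times> real \<Rightarrow> real^3) \<Rightarrow> real \<Rightarrow> real^3" where
  "strip_normal F s = cross3 (d1 (base F) s) (d2 (base F) s) - tan (angle1 F s) *\<^sub>R d2 (base F) s"

lemma curv_nonzero_on_normalized:
  "normalized l F \<Longrightarrow> s \<in> Jint l \<Longrightarrow> curv (base F) s \<noteq> 0"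
  using normalizedD[of l F s] by (auto simp: curv_def)

lemma strip_normal_differentiable:
  assumes st: "strip_on l C F I \<delta>" and "normalized l F" "s \<in> Jint l"
  obtains N' where "(strip_normal F has_vector_derivative N') (at s within Jint l)"
proof -
  note I = strip_onD(1)[OF st] and JI = strip_onD(2)[OF st] and c = strip_onD(4)[OF st]
    and x = strip_onD(5)[OF st]
  \<comment> \<open>On \<open>Jint l\<close> the strip normal agrees with N, whose quotient is
    smooth wherever its denominator does not vanish. S is an open set of such points around
    \<open>Jint l\<close>, so that the derivative exists at the endpoints too.\<close>
  define S where "S = {t \<in> I. rul F t \<bullet> d2 (base F) t \<noteq> 0}"
  have "continuous_on I (\<lambda>t. rul F t \<bullet> d2 (base F) t)"
    by (intro Cinf_on_continuous Cinf_on_inner Cinf_on_d2(1) I c x)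
  then have S: "open S"
    using continuous_open_preimage[OF _ I, of _ "- {0}"] by (auto simp: S_def vimage_def Int_def)
  have SI: "S \<subseteq> I" by (auto simp: S_def)
  have JS: "Jint l \<subseteq> S"
    using normalizedD[OF assms(2)] JI by (fastforce simp: S_def)
  note sm = Cinf_on_subset[OF c SI] Cinf_on_subset[OF Cinf_on_d1(1)[OF I c] SI]
    Cinf_on_subset[OF Cinf_on_d2(1)[OF I c] SI] Cinf_on_subset[OF x SI]
  define N where "N t = cross3 (d1 (base F) t) (d2 (base F) t)
     - ((rul F t \<bullet> cross3 (d1 (base F) t) (d2 (base F) t)) / (rul F t \<bullet> d2 (base F) t)) *\<^sub>R d2 (base F) t" for t
  have "Cinf_on S N"
    unfolding N_def
    by (intro Cinf_on_diff Cinf_on_cross3 Cinf_on_scaleR Cinf_on_divide Cinf_on_inner sm S) (simp add: S_def)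
  then have "(N has_vector_derivative d1 N s) (at s within Jint l)"
    using Cinf_on_d1(2)[OF S] JS assms(3) by (blast intro: has_vector_derivative_at_within)
  moreover have "strip_normal F t = N t" if "t \<in> Jint l" for t
    using tan_angle1[OF curv_nonzero_on_normalized[OF assms(2) that]] by (simp add: N_def strip_normal_def)
  ultimately show thesis
    using has_vector_derivative_transform[OF assms(3)] that by metis
qed

lemma strip_normal_orthogonal:
  assumes "l > 0" and st: "strip_on l C F I \<delta>" and "normalized l F" "s \<in> Jint l"
  shows "d1 (base F) s \<bullet> strip_normal F s = 0" "rul F s \<bullet> strip_normal F s = 0"
proof -
  show "d1 (base F) s \<bullet> strip_normal F s = 0"
    using d1_orthogonal_d2[OF assms(1) strip_onD(1,2,4,12)[OF st] assms(4)]
    by (simp add: strip_normal_def inner_diff_right dot_cross_self)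
  show "rul F s \<bullet> strip_normal F s = 0"
    using tan_angle1[OF curv_nonzero_on_normalized[OF assms(3,4)]] normalizedD[OF assms(3,4)]
    by (simp add: strip_normal_def inner_diff_right)
qed

text \<open>The strip normal is parallel to c' x \<xi>, hence flatness says that it is orthogonal to
  \<xi>'. Both products then come from differentiating the orthogonality of the normal to \<xi> and
  to c'. The second one measures how far the normal and its derivative are from being
  dependent.\<close>

lemma strip_normal_derivative:
  assumes "l > 0" and st: "strip_on l C F I \<delta>" and "normalized l F" "s \<in> Jint l"
    and N': "(strip_normal F has_vector_derivative N') (at s within Jint l)"
  shows "rul F s \<bullet> N' = 0"
    and "d1 (base F) s \<bullet> N' = tan (angle1 F s) * (d2 (base F) s \<bullet> d2 (base F) s)"
proof -
  note I = strip_onD(1)[OF st] and JI = strip_onD(2)[OF st] and c = strip_onD(4)[OF st]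
    and x = strip_onD(5)[OF st] and nz = strip_onD(9)[OF st] and dev = strip_onD(10)[OF st]
  have sI: "s \<in> I" using JI assms(4) by blast
  note orth = strip_normal_orthogonal[OF assms(1-3)]
  let ?X = "cross3 (d1 (base F) s) (rul F s)"
  have "(?X \<bullet> ?X) *\<^sub>R strip_normal F s = (?X \<bullet> strip_normal F s) *\<^sub>R ?X"
    using orth[OF assms(4)] by (intro orthogonal_imp_parallel_cross) (simp_all add: inner_commute)
  then have "(?X \<bullet> ?X) * (d1 (rul F) s \<bullet> strip_normal F s) = 0"
    using dev[OF sI] by (metis inner_scaleR_right mult_zero_right)
  then have \<xi>': "d1 (rul F) s \<bullet> strip_normal F s = 0"
    using nz[OF sI] by simp
  have d: "(rul F has_vector_derivative d1 (rul F) s) (at s within Jint l)"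
      "(d1 (base F) has_vector_derivative d2 (base F) s) (at s within Jint l)"
    using Cinf_on_d1(2)[OF I x sI] Cinf_on_d2(2)[OF I c sI] by (auto intro: has_vector_derivative_at_within)
  have "rul F s \<bullet> N' + d1 (rul F) s \<bullet> strip_normal F s = 0"
    by (rule Jint_unique_derivative[OF assms(1,4), of "\<lambda>t. rul F t \<bullet> strip_normal F t" "\<lambda>t. 0"],
        rule_tac [2] bounded_bilinear.has_vector_derivative[OF bounded_bilinear_inner d(1) N'])
       (auto simp: orth)
  then show "rul F s \<bullet> N' = 0" using \<xi>' by simp
  have "d1 (base F) s \<bullet> N' + d2 (base F) s \<bullet> strip_normal F s = 0"
    by (rule Jint_unique_derivative[OF assms(1,4), of "\<lambda>t. d1 (base F) t \<bullet> strip_normal F t" "\<lambda>t. 0"],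
        rule_tac [2] bounded_bilinear.has_vector_derivative[OF bounded_bilinear_inner d(2) N'])
       (auto simp: orth)
  then show "d1 (base F) s \<bullet> N' = tan (angle1 F s) * (d2 (base F) s \<bullet> d2 (base F) s)"
    by (simp add: strip_normal_def inner_diff_right dot_cross_self)
qed

text \<open>The ruling is orthogonal to the strip normal and to its derivative, and these are
  linearly independent as soon as the first angular function does not vanish.\<close>

lemma rul_unique:
  assumes l: "l > 0" and F: "strip_on l C F I \<delta>" "normalized l F" and G: "strip_on l C' G I' \<delta>'" "normalized l G"
    and base: "\<And>t. t \<in> Jint l \<Longrightarrow> base F t = base G t"
    and ang: "\<And>t. t \<in> Jint l \<Longrightarrow> angle1 F t = angle1 G t"
    and s: "s \<in> Jint l" and nz: "angle1 F s \<noteq> 0"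
  shows "rul F s = rul G s"
proof -
  note I = strip_onD(1)[OF F(1)] and JI = strip_onD(2)[OF F(1)] and c = strip_onD(4)[OF F(1)]
    and u = strip_onD(12)[OF F(1)] and nF = strip_onD(8)[OF F(1) strip_onD(13)[OF F(1) s]]
  note I' = strip_onD(1)[OF G(1)] and JI' = strip_onD(2)[OF G(1)] and c' = strip_onD(4)[OF G(1)]
    and nG = strip_onD(8)[OF G(1) strip_onD(13)[OF G(1) s]]
  have d: "d1 (base F) t = d1 (base G) t" "d2 (base F) t = d2 (base G) t" if "t \<in> Jint l" for t
    using d1_eq_on_Jint[OF l I I' JI JI' c c' base that] d2_eq_on_Jint[OF l I I' JI JI' c c' base that]
    by simp_all
  have N: "strip_normal F t = strip_normal G t" if "t \<in> Jint l" for t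
    using d[OF that] ang[OF that] by (simp add: strip_normal_def)
  obtain N' where N': "(strip_normal F has_vector_derivative N') (at s within Jint l)"
    using strip_normal_differentiable[OF F s] .
  have N'G: "(strip_normal G has_vector_derivative N') (at s within Jint l)"
    using has_vector_derivative_transform[OF s _ N', of "strip_normal G"] N by simp
  note NF = strip_normal_derivative[OF l F s N'] strip_normal_orthogonal[OF l F s]
  note NG = strip_normal_derivative[OF l G s N'G] strip_normal_orthogonal[OF l G s]
  have m: "d2 (base F) s \<noteq> 0" using normalizedD[OF F(2) s] by auto
  have om: "d1 (base F) s \<bullet> d2 (base F) s = 0"
    using d1_orthogonal_d2[OF l I JI c u s] .
  have "tan (angle1 F s) \<noteq> 0"
    using nz by (simp add: angle1_def tan_arctan)
  then have e: "d1 (base F) s \<bullet> N' \<noteq> 0"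
    using NF(2) m by simp
  have b: "cross3 (d1 (base F) s) (d2 (base F) s) \<noteq> 0"
  proof
    assume "cross3 (d1 (base F) s) (d2 (base F) s) = 0"
    then show False
      using norm_cross_dot[of "d1 (base F) s" "d2 (base F) s"] om u[OF s] m by simp
  qed
  have "strip_normal F s \<bullet> cross3 (d1 (base F) s) (d2 (base F) s)
        = cross3 (d1 (base F) s) (d2 (base F) s) \<bullet> cross3 (d1 (base F) s) (d2 (base F) s)"
    by (simp add: strip_normal_def inner_diff_left dot_cross_self)
  then have Nnz: "strip_normal F s \<noteq> 0" using b by auto
  \<comment> \<open>With c' orthogonal to N, Lagrange's identity leaves only (c' . N') N, and c' .
    N' \<noteq> 0 because \<alpha> \<noteq> 0. So N and N' are independent.\<close>
  have "cross3 (d1 (base F) s) (cross3 (strip_normal F s) N') = (d1 (base F) s \<bullet> N') *\<^sub>R strip_normal F s"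
    using NF(3) by (simp add: Lagrange)
  then have X: "cross3 (strip_normal F s) N' \<noteq> 0"
    using e Nnz by auto
  show ?thesis
    using unit_orthogonal_unique[OF NF(4,1) _ _ X nF nG normalizedD[OF F(2) s]]
      NG(1,4) N[OF s] d[OF s] normalizedD[OF G(2) s] by metis
qed

section \<open>Existence of strips with prescribed angular function\<close>

lemma dist_Pair_le: "dist (a, b) (c, d) \<le> dist a c + dist b d"
  by (simp add: dist_Pair_Pair sqrt_sum_squares_le_sum)

lemma clamp_Jint:
  assumes "l > 0" "\<eta> \<ge> 0" "s \<in> {-l/2 - \<eta>..l/2 + \<eta>}"
  shows "\<exists>s'\<in>Jint l. dist s' s \<le> \<eta>"
proof
  show "dist (max (-l/2) (min s (l/2))) s \<le> \<eta>" using assms by (auto simp: dist_real_def)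
  show "max (-l/2) (min s (l/2)) \<in> Jint l" using assms(1) by (auto simp: Jint_def)
qed

lemma compact_Jint: "compact (Jint l)"
  by (simp add: Jint_def)

lemma strip_nbhd:
  assumes "l > 0" "open U" "Jint l \<times> {0::real} \<subseteq> U"
  obtains \<eta> where "\<eta> > 0" "{-l/2 - \<eta>..l/2 + \<eta>} \<times> {-\<eta>..\<eta>} \<subseteq> U"
proof -
  obtain \<epsilon> where e: "\<epsilon> > 0" "(\<Union>x\<in>Jint l \<times> {0}. ball x \<epsilon>) \<subseteq> U"
    using compact_subset_open_imp_ball_epsilon_subset[OF compact_Times[OF compact_Jint compact_sing] assms(2,3)] .
  \<comment> \<open>Two coordinate errors of at most \<epsilon>/3 each keep the distance to the
    crease points below \<epsilon>.\<close>
  have "(s, v) \<in> U" if "s \<in> {-l/2 - \<epsilon>/3..l/2 + \<epsilon>/3}" "v \<in> {-\<epsilon>/3..\<epsilon>/3}" for s v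
  proof -
    obtain s' where s': "s' \<in> Jint l" "dist s' s \<le> \<epsilon>/3"
      using clamp_Jint[of l "\<epsilon>/3" s] \<open>s \<in> _\<close> assms(1) e(1) by auto
    have "dist (s', 0) (s, v) < \<epsilon>"
      using dist_Pair_le[of s' 0 s v] s'(2) that(2) e(1) by (simp add: dist_real_def) argo
    then have "(s, v) \<in> (\<Union>x\<in>Jint l \<times> {0}. ball x \<epsilon>)" using s'(1) by (intro UN_I[of "(s', 0)"]) auto
    then show ?thesis using e(2) by blast
  qed
  then have "{-l/2 - \<epsilon>/3..l/2 + \<epsilon>/3} \<times> {-\<epsilon>/3..\<epsilon>/3} \<subseteq> U" by (intro subsetI) (metis mem_Sigma_iff prod.collapse)
  then show thesis using that[of "\<epsilon>/3"] e(1) by simp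
qed

text \<open>Injectivity is a condition on pairs of points; compactness of the set of pairs on the
  crease turns an open set of good pairs into one rectangle that works uniformly.\<close>

lemma strip_pair_nbhd:
  assumes "l > 0" "open V" "(Jint l \<times> {0::real}) \<times> (Jint l \<times> {0::real}) \<subseteq> V"
  obtains \<eta> where "\<eta> > 0"
    "\<And>p q. p \<in> {-l/2 - \<eta>..l/2 + \<eta>} \<times> {-\<eta>..\<eta>} \<Longrightarrow> q \<in> {-l/2 - \<eta>..l/2 + \<eta>} \<times> {-\<eta>..\<eta>} \<Longrightarrow> (p, q) \<in> V"
proof -
  let ?K = "Jint l \<times> {0::real}"
  have "compact (?K \<times> ?K)"
    by (intro compact_Times compact_Jint compact_sing)
  then obtain \<epsilon> where e: "\<epsilon> > 0" "(\<Union>x\<in>?K \<times> ?K. ball x \<epsilon>) \<subseteq> V"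
    using compact_subset_open_imp_ball_epsilon_subset[OF _ assms(2,3)] by blast
  \<comment> \<open>Each point of the pair is moved by at most 2 \<eta>, the pair by at most 4
    \<eta>, which is less than \<epsilon>.\<close>
  define \<eta> where "\<eta> = \<epsilon>/5"
  have \<eta>: "\<eta> > 0" using e by (simp add: \<eta>_def)
  have near: "\<exists>p'\<in>?K. dist p' p \<le> 2 * \<eta>" if p: "p \<in> {-l/2 - \<eta>..l/2 + \<eta>} \<times> {-\<eta>..\<eta>}" for p :: "real \<times> real"
  proof -
    obtain s' where s': "s' \<in> Jint l" "dist s' (fst p) \<le> \<eta>"
      using clamp_Jint[of l \<eta> "fst p"] assms(1) \<eta> p by (auto simp: mem_Times_iff)
    have "dist (s', 0) (fst p, snd p) \<le> 2 * \<eta>"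
      using dist_Pair_le[of s' 0 "fst p" "snd p"] s'(2) p by (auto simp: dist_real_def)
    then show ?thesis using s'(1) by (intro bexI[of _ "(s', 0)"]) auto
  qed
  have "(p, q) \<in> V" if pq: "p \<in> {-l/2 - \<eta>..l/2 + \<eta>} \<times> {-\<eta>..\<eta>}" "q \<in> {-l/2 - \<eta>..l/2 + \<eta>} \<times> {-\<eta>..\<eta>}" for p q
  proof -
    obtain p' q' where p'q': "p' \<in> ?K" "dist p' p \<le> 2 * \<eta>" "q' \<in> ?K" "dist q' q \<le> 2 * \<eta>"
      using near[OF pq(1)] near[OF pq(2)] by blast
    have "dist (p', q') (p, q) < \<epsilon>"
      using dist_Pair_le[of p' q' p q] p'q' \<eta> by (simp add: \<eta>_def)
    then have "(p, q) \<in> (\<Union>x\<in>?K \<times> ?K. ball x \<epsilon>)"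
      using p'q' by (intro UN_I[of "(p', q')"]) auto
    then show ?thesis using e(2) by blast
  qed
  then show thesis using that \<eta> by blast
qed

lemma continuous_on_fst_compose:
  assumes "Cinf_on I f"
  shows "continuous_on (I \<times> UNIV) (\<lambda>p. f (fst p))"
  by (rule continuous_on_compose2[OF Cinf_on_continuous[OF assms]]) (auto intro: continuous_intros)

lemma cross_nonzero_imp_independent:
  fixes a b :: "real^3"
  assumes "cross3 a b \<noteq> 0" "x *\<^sub>R a + y *\<^sub>R b = 0"
  shows "x = 0" "y = 0"
proof -
  have *: "cross3 (x *\<^sub>R a + y *\<^sub>R b) b = x *\<^sub>R cross3 a b" "cross3 a (x *\<^sub>R a + y *\<^sub>R b) = y *\<^sub>R cross3 a b"
    by (simp_all add: cross_add_left cross_add_right cross_mult_left cross_mult_right)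
  show "x = 0" "y = 0"
    using *[unfolded assms(2)] assms(1) by auto
qed

text \<open>The columns of the differential at (s0, v0) are c' + v0 \<xi>' and \<xi>, which are
  independent by the cross product condition. The target has a larger dimension than the domain, so
  a left inverse of the differential, together with its continuity in the operator norm, takes the
  place of the inverse function theorem.\<close>

lemma ruled_local_inj:
  fixes c x :: "real \<Rightarrow> real^3"
  assumes I: "open I" and c: "Cinf_on I c" and x: "Cinf_on I x" and s0: "s0 \<in> I"
    and nz: "cross3 (d1 c s0 + v0 *\<^sub>R d1 x s0) (x s0) \<noteq> 0"
  obtains r where "r > 0" "inj_on (\<lambda>p. c (fst p) + snd p *\<^sub>R x (fst p)) (ball (s0, v0) r)"
proof -
  let ?F = "\<lambda>p. c (fst p) + snd p *\<^sub>R x (fst p)"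
  define A where "A p = d1 c (fst p) + snd p *\<^sub>R d1 x (fst p)" for p
  define B where "B p = x (fst p)" for p :: "real \<times> real"
  define F' where "F' p h = fst h *\<^sub>R A p + snd h *\<^sub>R B p" for p h :: "real \<times> real"
  have O: "open (I \<times> (UNIV::real set))" using I by (simp add: open_Times)
  have der: "(?F has_derivative F' p) (at p)" if "p \<in> I \<times> UNIV" for p
  proof -
    have p: "fst p \<in> I" using that by auto
    have 1: "((\<lambda>p. c (fst p)) has_derivative (\<lambda>h. fst h *\<^sub>R d1 c (fst p))) (at p)"
      using Cinf_on_d1(2)[OF I c p]
      by (intro has_derivative_compose[of fst fst p UNIV c, unfolded o_def])
         (auto simp: has_vector_derivative_def intro!: derivative_intros)
    have 2: "((\<lambda>p. x (fst p)) has_derivative (\<lambda>h. fst h *\<^sub>R d1 x (fst p))) (at p)"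
      using Cinf_on_d1(2)[OF I x p]
      by (intro has_derivative_compose[of fst fst p UNIV x, unfolded o_def])
         (auto simp: has_vector_derivative_def intro!: derivative_intros)
    show ?thesis
      using has_derivative_add[OF 1 has_derivative_scaleR[OF has_derivative_snd[OF has_derivative_ident] 2]]
      by (rule has_derivative_eq_rhs) (auto simp: F'_def A_def B_def fun_eq_iff algebra_simps)
  qed
  have lin: "linear (F' (s0, v0))"
    by (rule linearI) (auto simp: F'_def algebra_simps)
  have "inj (F' (s0, v0))"
    unfolding linear_injective_0[OF lin]
    using cross_nonzero_imp_independent[OF nz] by (auto simp: F'_def A_def B_def zero_prod_def)
  then obtain g' where g': "linear g'" "g' \<circ> F' (s0, v0) = id"
    using linear_injective_left_inverse[OF lin] by blast
  have cA: "continuous_on (I \<times> UNIV) A" unfolding A_def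
    by (intro continuous_intros continuous_on_fst_compose Cinf_on_d1(1) I c x)
  have cB: "continuous_on (I \<times> UNIV) B" unfolding B_def
    by (intro continuous_on_fst_compose x)
  \<comment> \<open>Each of the two columns is kept within e/3; the sum 2e/3 leaves room for the
    required strict inequality.\<close>
  have on: "\<exists>d>0. \<forall>p. dist (s0, v0) p < d \<longrightarrow> onorm (\<lambda>h. F' p h - F' (s0, v0) h) < e" if "e > 0" for e
  proof -
    have "isCont A (s0, v0)" "isCont B (s0, v0)"
      using cA cB O s0 by (auto simp: continuous_on_eq_continuous_at)
    moreover have "e/3 > 0" using that by simp
    ultimately obtain da db where d: "da > 0" "\<And>p. dist p (s0, v0) < da \<Longrightarrow> dist (A p) (A (s0, v0)) < e/3"
      "db > 0" "\<And>p. dist p (s0, v0) < db \<Longrightarrow> dist (B p) (B (s0, v0)) < e/3"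
      unfolding continuous_at_eps_delta by metis
    have "onorm (\<lambda>h. F' p h - F' (s0, v0) h) < e" if p: "dist (s0, v0) p < min da db" for p
    proof -
      have n: "norm (A p - A (s0, v0)) \<le> e/3" "norm (B p - B (s0, v0)) \<le> e/3"
        using d(2)[of p] d(4)[of p] p by (auto simp: dist_norm norm_minus_commute)
      have "onorm (\<lambda>h. F' p h - F' (s0, v0) h) \<le> 2*e/3"
      proof (rule onorm_le)
        fix h :: "real \<times> real"
        have "F' p h - F' (s0, v0) h = fst h *\<^sub>R (A p - A (s0, v0)) + snd h *\<^sub>R (B p - B (s0, v0))"
          by (simp add: F'_def algebra_simps)
        also have "norm \<dots> \<le> \<bar>fst h\<bar> * norm (A p - A (s0, v0)) + \<bar>snd h\<bar> * norm (B p - B (s0, v0))"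
          by (metis norm_scaleR norm_triangle_ineq)
        also have "\<dots> \<le> norm h * (e/3) + norm h * (e/3)"
          using norm_fst_le[of "fst h" "snd h"] norm_snd_le[of "snd h" "fst h"]
          by (intro add_mono mult_mono n) auto
        finally show "norm (F' p h - F' (s0, v0) h) \<le> 2*e/3 * norm h" by (simp add: algebra_simps)
      qed
      then show ?thesis using \<open>e > 0\<close> by simp
    qed
    then show ?thesis using d(1,3) by (intro exI[of _ "min da db"]) auto
  qed
  show thesis
    using has_derivative_locally_injective[of "(s0, v0)" "I \<times> UNIV" g' F' ?F, OF _ O _ g'(2) der on]
      s0 g'(1) that by (auto simp: linear_conv_bounded_linear)
qed

text \<open>Pairs of distinct crease points lie in V1 since c is injective, and diagonal pairs lie
  in V2 by local injectivity. A pair in the union with equal images consists of one point twice, so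
  a rectangle all of whose pairs lie in the union is mapped injectively.\<close>

lemma ruled_embedding:
  fixes c x :: "real \<Rightarrow> real^3"
  assumes l: "l > 0" and I: "open I" and JI: "Jint l \<subseteq> I" and c: "Cinf_on I c" and x: "Cinf_on I x"
    and inj: "inj_on c (Jint l)" and nz: "\<forall>s\<in>Jint l. cross3 (d1 c s) (x s) \<noteq> 0"
  shows "\<exists>\<eta>>0. {-l/2 - \<eta>..l/2 + \<eta>} \<subseteq> I \<and>
    inj_on (\<lambda>p. c (fst p) + snd p *\<^sub>R x (fst p)) ({-l/2 - \<eta>..l/2 + \<eta>} \<times> {-\<eta>..\<eta>}) \<and>
    (\<forall>s\<in>{-l/2 - \<eta>..l/2 + \<eta>}. \<forall>v\<in>{-\<eta>..\<eta>}. cross3 (d1 c s + v *\<^sub>R d1 x s) (x s) \<noteq> 0)"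
proof -
  let ?F = "\<lambda>p. c (fst p) + snd p *\<^sub>R x (fst p)"
  let ?\<Omega> = "I \<times> (UNIV :: real set)"
  let ?K = "Jint l \<times> {0::real}"
  have O: "open ?\<Omega>" using I by (simp add: open_Times)
  have cF: "continuous_on ?\<Omega> ?F"
    by (intro continuous_intros continuous_on_fst_compose c x)
  define U where "U = {p \<in> ?\<Omega>. cross3 (d1 c (fst p) + snd p *\<^sub>R d1 x (fst p)) (x (fst p)) \<noteq> 0}"
  have "continuous_on ?\<Omega> (\<lambda>p. cross3 (d1 c (fst p) + snd p *\<^sub>R d1 x (fst p)) (x (fst p)))"
    by (intro continuous_intros continuous_on_cross continuous_on_fst_compose Cinf_on_d1(1) I c x)
  from continuous_open_preimage[OF this O, of "- {0}"] have U: "open U"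
    by (auto simp: U_def vimage_def Int_def)
  have KU: "?K \<subseteq> U" using nz JI by (auto simp: U_def)
  define V1 where "V1 = {z \<in> ?\<Omega> \<times> ?\<Omega>. ?F (fst z) - ?F (snd z) \<noteq> 0}"
  define R where "R = {(p, r). inj_on ?F (ball p r)}"
  define V2 where "V2 = (\<Union>(p, r)\<in>R. ball p r \<times> ball p r)"
  have "continuous_on (?\<Omega> \<times> ?\<Omega>) (\<lambda>z. ?F (fst z) - ?F (snd z))"
    by (intro continuous_on_diff continuous_on_compose2[OF cF]) (auto intro!: continuous_intros)
  from continuous_open_preimage[OF this open_Times[OF O O], of "- {0}"] have V1: "open V1"
    by (auto simp: V1_def vimage_def Int_def)
  have V2: "open V2"
    unfolding V2_def by (auto intro!: open_Union open_Times)
  have sub: "?K \<times> ?K \<subseteq> V1 \<union> V2"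
  proof
    fix z assume "z \<in> ?K \<times> ?K"
    then obtain s t where z: "z = ((s, 0), (t, 0))" and st: "s \<in> Jint l" "t \<in> Jint l"
      by auto
    show "z \<in> V1 \<union> V2"
    proof (cases "s = t")
      case True
      obtain r where "r > 0" "inj_on ?F (ball (s, 0) r)"
        using ruled_local_inj[OF I c x, of s 0] JI nz st by auto
      then have "((s, 0), (s, 0)) \<in> V2"
        unfolding V2_def R_def by (intro UN_I[of "((s, 0), r)"]) auto
      then show ?thesis using True z by simp
    next
      case False
      then have "c s \<noteq> c t" using inj st by (auto dest: inj_onD)
      then show ?thesis using st JI by (auto simp: z V1_def)
    qed
  qed
  have V: "p = q" if "(p, q) \<in> V1 \<union> V2" "?F p = ?F q" for p q
    using that unfolding V1_def V2_def R_def by (auto dest: inj_onD)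
  obtain \<eta>1 where \<eta>1: "\<eta>1 > 0" "{-l/2 - \<eta>1..l/2 + \<eta>1} \<times> {-\<eta>1..\<eta>1} \<subseteq> U"
    using strip_nbhd[OF l U KU] .
  obtain \<eta>2 where \<eta>2: "\<eta>2 > 0" "\<And>p q. p \<in> {-l/2 - \<eta>2..l/2 + \<eta>2} \<times> {-\<eta>2..\<eta>2} \<Longrightarrow>
      q \<in> {-l/2 - \<eta>2..l/2 + \<eta>2} \<times> {-\<eta>2..\<eta>2} \<Longrightarrow> (p, q) \<in> V1 \<union> V2"
    using strip_pair_nbhd[OF l _ sub] V1 V2 by (metis open_Un)
  define \<eta> where "\<eta> = min \<eta>1 \<eta>2"
  have \<eta>: "\<eta> > 0" "\<eta> \<le> \<eta>1" "\<eta> \<le> \<eta>2" using \<eta>1 \<eta>2 by (auto simp: \<eta>_def)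
  have inU: "(s, v) \<in> U" if "s \<in> {-l/2 - \<eta>..l/2 + \<eta>}" "v \<in> {-\<eta>..\<eta>}" for s v
    using that \<eta> by (intro subsetD[OF \<eta>1(2)]) auto
  show ?thesis
  proof (intro exI[of _ \<eta>] conjI ballI)
    show "\<eta> > 0" by fact
    show "{-l/2 - \<eta>..l/2 + \<eta>} \<subseteq> I"
      using inU[of _ 0] \<eta>(1) by (auto simp: U_def)
    show "cross3 (d1 c s + v *\<^sub>R d1 x s) (x s) \<noteq> 0" if "s \<in> {-l/2 - \<eta>..l/2 + \<eta>}" "v \<in> {-\<eta>..\<eta>}" for s v
      using inU[OF that] by (simp add: U_def)
    show "inj_on ?F ({-l/2 - \<eta>..l/2 + \<eta>} \<times> {-\<eta>..\<eta>})"
    proof (rule inj_onI)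
      fix p q assume pq: "p \<in> {-l/2 - \<eta>..l/2 + \<eta>} \<times> {-\<eta>..\<eta>}" "q \<in> {-l/2 - \<eta>..l/2 + \<eta>} \<times> {-\<eta>..\<eta>}"
        and eq: "?F p = ?F q"
      have "(p, q) \<in> V1 \<union> V2" using pq \<eta> by (intro \<eta>2(2)) auto
      then show "p = q" using V eq by blast
    qed
  qed
qed

lemma cross_dot_cross: "cross3 a b \<bullet> cross3 a d = (a \<bullet> a) * (b \<bullet> d) - (a \<bullet> d) * (a \<bullet> b)"
  by (simp add: cross3_simps)

text \<open>All three vectors lie in the plane orthogonal to n. With n a normal field along the
  crease, this is how flatness of a constructed strip is obtained.\<close>

lemma orthogonal_imp_coplanar:
  fixes n :: "real^3"
  assumes "n \<noteq> 0" "n \<bullet> a = 0" "n \<bullet> b = 0" "n \<bullet> d = 0"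
  shows "d \<bullet> cross3 a b = 0"
proof -
  have *: "(cross3 a b \<bullet> cross3 a b) *\<^sub>R n = (cross3 a b \<bullet> n) *\<^sub>R cross3 a b"
    by (rule orthogonal_imp_parallel_cross[OF assms(2,3)])
  have "d \<bullet> ((cross3 a b \<bullet> cross3 a b) *\<^sub>R n) = d \<bullet> ((cross3 a b \<bullet> n) *\<^sub>R cross3 a b)"
    by (simp only: *)
  then have "cross3 a b \<bullet> n = 0 \<or> d \<bullet> cross3 a b = 0"
    using assms(4) by (simp add: inner_commute)
  moreover have "cross3 a b = 0" if "cross3 a b \<bullet> n = 0"
    using * that assms(1) by simp
  ultimately show ?thesis by auto
qed

text \<open>The ruling of a developable strip with normal field \<open>N\<close> along the crease is
  the direction of \<open>N \<times> N'\<close>; the factor \<open>t\<close> fixes the sign so that the ruling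
  points to the side of the principal normal.\<close>

lemma strip_exists:
  fixes c :: "real \<Rightarrow> real^3" and t :: "real \<Rightarrow> real"
  assumes l: "l > 0" and I: "open I" and JI: "Jint l \<subseteq> I" and c: "Cinf_on I c"
    and unit: "\<And>s. s \<in> Jint l \<Longrightarrow> norm (d1 c s) = 1" and inj: "inj_on c (Jint l)"
    and curv: "\<And>s. s \<in> Jint l \<Longrightarrow> curv c s \<noteq> 0"
    and t: "Cinf_on I t" and t0: "\<And>s. s \<in> Jint l \<Longrightarrow> t s \<noteq> 0"
  shows "\<exists>F. normal_form l (c ` Jint l) F \<and> normalized l F \<and>
    (\<forall>s\<in>Jint l. base F s = c s) \<and> (\<forall>s\<in>Jint l. tan (angle1 F s) = t s)"
proof -
  note c' = Cinf_on_d1(1)[OF I c] and c'' = Cinf_on_d2(1)[OF I c]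
  \<comment> \<open>The last vector equals c'' on \<open>Jint l\<close>, where c has unit speed.
    Writing it as a double cross product makes N orthogonal to c' on the whole line, and flatness
    has to hold beyond \<open>Jint l\<close> as well.\<close>
  define N where "N s = cross3 (d1 c s) (d2 c s) - t s *\<^sub>R cross3 (cross3 (d1 c s) (d2 c s)) (d1 c s)" for s
  have N: "Cinf_on I N"
    unfolding N_def[abs_def] by (intro Cinf_on_diff Cinf_on_scaleR Cinf_on_cross3 I c' c'' t)
  define Y where "Y s = t s *\<^sub>R cross3 (N s) (d1 N s)" for s
  have Y: "Cinf_on I Y"
    unfolding Y_def[abs_def] by (intro Cinf_on_scaleR Cinf_on_cross3 I t N Cinf_on_d1(1))
  define S where "S = {s \<in> I. Y s \<noteq> 0}"
  have S: "open S"
    using continuous_open_preimage[OF Cinf_on_continuous[OF Y] I, of "- {0}"]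
    by (auto simp: S_def vimage_def Int_def)
  have SI: "S \<subseteq> I" by (auto simp: S_def)
  have Nc': "N s \<bullet> d1 c s = 0" for s
    by (simp add: N_def inner_diff_left dot_cross_self)
  have N'c': "d1 N s \<bullet> d1 c s = - (N s \<bullet> d2 c s)" if "s \<in> I" for s
  proof -
    have "((\<lambda>s. N s \<bullet> d1 c s) has_vector_derivative N s \<bullet> d2 c s + d1 N s \<bullet> d1 c s) (at s)"
      by (intro bounded_bilinear.has_vector_derivative[OF bounded_bilinear_inner]
          Cinf_on_d1(2)[OF I N that] Cinf_on_d2(2)[OF I c that])
    moreover have "((\<lambda>s. N s \<bullet> d1 c s) has_vector_derivative 0) (at s)"
      by (simp add: Nc')
    ultimately show ?thesis using vector_derivative_unique_at by fastforce
  qed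
  \<comment> \<open>Y . (N x c') is evaluated twice: from Y = t N x N' and N' . c' = - N . c'', and
    from N x c' = c'' + t c' x c'' with Y . N = 0. Comparison gives (1 + t^2) (Y . c'') = t^2 |N|^2
    |c''|^2, which is positive as t \<noteq> 0.\<close>
  have Ym: "Y s \<bullet> d2 c s > 0" if s: "s \<in> Jint l" for s
  proof -
    have sI: "s \<in> I" using s JI by blast
    have em: "d1 c s \<bullet> d2 c s = 0"
      by (rule d1_orthogonal_d2[OF l I JI c unit s])
    have ee: "d1 c s \<bullet> d1 c s = 1" using unit[OF s] by (simp add: norm_eq_1)
    have m: "d2 c s \<noteq> 0" using curv[OF s] by (auto simp: curv_def)
    have "cross3 (cross3 (d1 c s) (d2 c s)) (d1 c s) = - cross3 (d1 c s) (cross3 (d1 c s) (d2 c s))"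
      by (rule cross_skew)
    also have "\<dots> = d2 c s" by (simp add: Lagrange em ee)
    finally have w: "cross3 (cross3 (d1 c s) (d2 c s)) (d1 c s) = d2 c s" .
    have Ns: "N s = cross3 (d1 c s) (d2 c s) - t s *\<^sub>R d2 c s"
      by (simp add: N_def w)
    have Nm: "N s \<bullet> d2 c s = - t s * (d2 c s \<bullet> d2 c s)"
      by (simp add: Ns inner_diff_left dot_cross_self)
    have Nnz: "N s \<noteq> 0"
      using Nm m t0[OF s] by auto
    have "cross3 (d2 c s) (d1 c s) = - cross3 (d1 c s) (d2 c s)" by (rule cross_skew)
    then have "cross3 (N s) (d1 c s) = d2 c s + t s *\<^sub>R cross3 (d1 c s) (d2 c s)"
      unfolding Ns by (simp add: Cross3.left_diff_distrib w cross_mult_left)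
    moreover have "Y s \<bullet> cross3 (N s) (d1 c s) = (t s)\<^sup>2 * (N s \<bullet> N s) * (d2 c s \<bullet> d2 c s)"
      by (simp add: Y_def cross_dot_cross Nc' N'c'[OF sI] Nm power2_eq_square)
    moreover have "Y s \<bullet> N s = 0"
      by (simp add: Y_def inner_commute[of _ "N s"] dot_cross_self)
    then have "Y s \<bullet> cross3 (d1 c s) (d2 c s) = t s * (Y s \<bullet> d2 c s)"
      by (simp add: Ns inner_diff_right)
    ultimately have "(1 + (t s)\<^sup>2) * (Y s \<bullet> d2 c s) = (t s)\<^sup>2 * (N s \<bullet> N s) * (d2 c s \<bullet> d2 c s)"
      by (simp add: inner_add_right algebra_simps power2_eq_square)
    also have "\<dots> > 0" using t0[OF s] Nnz m by simp
    finally show ?thesis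
      by (simp add: zero_less_mult_iff add_pos_nonneg not_less[symmetric])
         (smt (verit) zero_le_power2)
  qed
  have JS: "Jint l \<subseteq> S"
  proof
    fix s assume "s \<in> Jint l"
    then show "s \<in> S" using Ym[of s] JI by (auto simp: S_def)
  qed
  define \<xi> where "\<xi> s = inverse (norm (Y s)) *\<^sub>R Y s" for s
  have \<xi>: "Cinf_on S \<xi>"
    unfolding \<xi>_def[abs_def]
    by (intro Cinf_on_scaleR Cinf_on_inverse Cinf_on_norm S Cinf_on_subset[OF Y SI]) (auto simp: S_def)
  have cS: "Cinf_on S c" and NS: "Cinf_on S N"
    using Cinf_on_subset[OF _ SI] c N by blast+
  have \<xi>N: "\<xi> s \<bullet> N s = 0" and \<xi>N': "\<xi> s \<bullet> d1 N s = 0" for s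
    by (simp_all add: \<xi>_def Y_def dot_cross_self inner_commute[of _ "N s"])
  have \<xi>m: "\<xi> s \<bullet> d2 c s > 0" if "s \<in> Jint l" for s
    using Ym[OF that] by (auto simp: \<xi>_def zero_less_mult_iff)
  have \<xi>'N: "d1 \<xi> s \<bullet> N s = 0" if "s \<in> S" for s
  proof -
    have "((\<lambda>s. \<xi> s \<bullet> N s) has_vector_derivative \<xi> s \<bullet> d1 N s + d1 \<xi> s \<bullet> N s) (at s)"
      by (intro bounded_bilinear.has_vector_derivative[OF bounded_bilinear_inner]
          Cinf_on_d1(2)[OF S NS that] Cinf_on_d1(2)[OF S \<xi> that])
    moreover have "((\<lambda>s. \<xi> s \<bullet> N s) has_vector_derivative 0) (at s)"
      by (simp add: \<xi>N)
    ultimately show ?thesis using vector_derivative_unique_at \<xi>N' by fastforce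
  qed
  have dev: "d1 \<xi> s \<bullet> cross3 (d1 c s) (\<xi> s) = 0" if "s \<in> S" for s
  proof (rule orthogonal_imp_coplanar[of "N s"])
    show "N s \<noteq> 0" using that by (auto simp: S_def Y_def)
  qed (use Nc' \<xi>N \<xi>'N[OF that] in \<open>simp_all add: inner_commute\<close>)
  have nz: "cross3 (d1 c s) (\<xi> s) \<noteq> 0" if s: "s \<in> Jint l" for s
  proof
    assume 0: "cross3 (d1 c s) (\<xi> s) = 0"
    have "cross3 (d1 c s) (cross3 (d1 c s) (\<xi> s)) = (d1 c s \<bullet> \<xi> s) *\<^sub>R d1 c s - \<xi> s"
      using unit[OF s] by (simp add: Lagrange norm_eq_1)
    then have "\<xi> s = (d1 c s \<bullet> \<xi> s) *\<^sub>R d1 c s" by (simp add: 0)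
    then have "\<xi> s \<bullet> d2 c s = (d1 c s \<bullet> \<xi> s) * (d1 c s \<bullet> d2 c s)"
      by (metis inner_scaleR_left)
    then show False
      using \<xi>m[OF s] d1_orthogonal_d2[OF l I JI c unit s] by simp
  qed
  obtain \<eta> where \<eta>: "\<eta> > 0" "{-l/2 - \<eta>..l/2 + \<eta>} \<subseteq> S"
    and injF: "inj_on (\<lambda>p. c (fst p) + snd p *\<^sub>R \<xi> (fst p)) ({-l/2 - \<eta>..l/2 + \<eta>} \<times> {-\<eta>..\<eta>})"
    and imm: "\<forall>s\<in>{-l/2 - \<eta>..l/2 + \<eta>}. \<forall>v\<in>{-\<eta>..\<eta>}. cross3 (d1 c s + v *\<^sub>R d1 \<xi> s) (\<xi> s) \<noteq> 0"
    using ruled_embedding[OF l S JS cS \<xi> inj] nz by blast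
  define F where "F = (\<lambda>p. c (fst p) + snd p *\<^sub>R \<xi> (fst p))"
  define K where "K = {-l/2 - \<eta>..l/2 + \<eta>} \<times> {-\<eta>..\<eta>}"
  define U where "U = {-l/2 - \<eta><..<l/2 + \<eta>}"
  have baseF: "base F = c" by (simp add: base_def F_def fun_eq_iff)
  have rulF: "rul F = \<xi>"
  proof
    fix s
    have "((\<lambda>v. c s + v *\<^sub>R \<xi> s) has_vector_derivative \<xi> s) (at 0)"
      by (auto intro!: derivative_eq_intros)
    then show "rul F s = \<xi> s" by (simp add: rul_def F_def vector_derivative_at)
  qed
  have US: "U \<subseteq> S" using \<eta>(2) by (force simp: U_def)
  have UK: "U \<times> {-\<eta><..<\<eta>} \<subseteq> K" by (auto simp: U_def K_def)
  have JU: "Jint l \<subseteq> U" using \<eta>(1) by (auto simp: Jint_def U_def)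
  have ruled: "ruled_on U \<eta> F"
    unfolding ruled_on_def baseF rulF
    using \<eta>(1) Cinf_on_subset[OF cS US] Cinf_on_subset[OF \<xi> US] by (auto simp: U_def F_def)
  have cross: "cross3 (pu F p) (pv F p) \<noteq> 0" if "p \<in> U \<times> {-\<eta><..<\<eta>}" for p
  proof -
    obtain s v where p: "p = (s, v)" "s \<in> U" "\<bar>v\<bar> < \<eta>" using \<open>p \<in> _\<close> by auto
    then have "cross3 (d1 c s + v *\<^sub>R d1 \<xi> s) (\<xi> s) \<noteq> 0"
      by (intro imm[rule_format]) (use p in \<open>auto simp: U_def\<close>)
    then show ?thesis
      using ruled_pu[OF ruled p(2,3)] ruled_pv[OF ruled p(2,3)] p(1) by (simp add: baseF rulF)
  qed
  have contF: "continuous_on K F"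
    unfolding F_def
    by (rule continuous_on_subset[of "S \<times> UNIV"], intro continuous_intros continuous_on_fst_compose cS \<xi>)
       (use \<eta>(2) in \<open>auto simp: K_def\<close>)
  have injK: "inj_on F K" using injF by (simp add: F_def K_def)
  \<comment> \<open>Compactness of the closed rectangle K makes the inverse continuous; on the image
    of the open rectangle the two choices of \<open>inv_into\<close> agree.\<close>
  have "continuous_on (F ` K) (inv_into K F)"
  proof (rule continuous_on_inv[OF contF])
    show "compact K" by (simp add: K_def compact_Times)
  qed (simp add: injK)
  then have "continuous_on (F ` (U \<times> {-\<eta><..<\<eta>})) (inv_into K F)"
    by (rule continuous_on_subset) (use UK in blast)
  moreover have "inv_into K F y = inv_into (U \<times> {-\<eta><..<\<eta>}) F y" if y: "y \<in> F ` (U \<times> {-\<eta><..<\<eta>})" for y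
  proof -
    obtain p where p: "p \<in> U \<times> {-\<eta><..<\<eta>}" "y = F p" using y by blast
    then show ?thesis
      using inv_into_f_f[OF injK, of p] inv_into_f_f[OF inj_on_subset[OF injK UK], of p] UK by (metis subsetD)
  qed
  ultimately have "continuous_on (F ` (U \<times> {-\<eta><..<\<eta>})) (inv_into (U \<times> {-\<eta><..<\<eta>}) F)"
    by (simp cong: continuous_on_cong)
  then have emb: "embedding_on (U \<times> {-\<eta><..<\<eta>}) F"
    unfolding embedding_on_def
    using inj_on_subset[OF injK UK] continuous_on_subset[OF contF UK] cross by blast
  have gauss: "gauss_curv F p = 0" if "p \<in> U \<times> {-\<eta><..<\<eta>}" for p
  proof -
    obtain s v where p: "p = (s, v)" "s \<in> U" "\<bar>v\<bar> < \<eta>" using \<open>p \<in> _\<close> by auto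
    then show ?thesis
      using ruled_gauss_curv_eq_0_iff[OF ruled p(2,3)] cross[OF that] dev[of s] US
      by (auto simp: baseF rulF)
  qed
  have n1: "norm (rul F s) = 1" if "s \<in> U" for s
    using that US by (auto simp: rulF \<xi>_def S_def)
  have nf: "normal_form l (c ` Jint l) F"
    unfolding normal_form_def
    by (intro conjI exI[of _ U] exI[of _ \<eta>])
       (use ruled[unfolded ruled_on_def] JU n1 emb gauss unit in \<open>simp_all add: baseF\<close>)
  have norm: "normalized l F"
    using \<xi>m curv by (auto simp: normalized_def pnormal_def baseF rulF curv_def)
  have "tan (angle1 F s) = t s" if s: "s \<in> Jint l" for s
  proof -
    have em: "d1 c s \<bullet> d2 c s = 0"
      by (rule d1_orthogonal_d2[OF l I JI c unit s])
    have ee: "d1 c s \<bullet> d1 c s = 1" using unit[OF s] by (simp add: norm_eq_1)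
    have "cross3 (cross3 (d1 c s) (d2 c s)) (d1 c s) = - cross3 (d1 c s) (cross3 (d1 c s) (d2 c s))"
      by (rule cross_skew)
    also have "\<dots> = d2 c s" by (simp add: Lagrange em ee)
    finally have "\<xi> s \<bullet> cross3 (d1 c s) (d2 c s) = t s * (\<xi> s \<bullet> d2 c s)"
      using \<xi>N[of s] by (simp add: N_def inner_diff_right)
    then show ?thesis
      using tan_angle1[of F s] curv[OF s] \<xi>m[OF s] by (simp add: baseF rulF)
  qed
  then show ?thesis using nf norm baseF by metis
qed

section \<open>Unit speed parametrizations of an arc\<close>

lemma tendsto_difference_quotient:
  assumes "(f has_vector_derivative D) (at x within S)"
  shows "((\<lambda>y. inverse (y - x) *\<^sub>R (f y - f x)) \<longlongrightarrow> D) (at x within S)"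
proof -
  have lim: "((\<lambda>y. (1 / norm (y - x)) *\<^sub>R (f y - (f x + (y - x) *\<^sub>R D))) \<longlongrightarrow> 0) (at x within S)"
    using assms by (simp add: has_vector_derivative_def has_derivative_within)
  have ev: "\<forall>\<^sub>F y in at x within S. norm ((1 / norm (y - x)) *\<^sub>R (f y - (f x + (y - x) *\<^sub>R D)))
      = norm (inverse (y - x) *\<^sub>R (f y - f x) - D)"
    unfolding eventually_at_filter
  proof (intro always_eventually allI impI)
    fix y assume "y \<noteq> x"
    then have "inverse (y - x) *\<^sub>R (f y - f x) - D = inverse (y - x) *\<^sub>R (f y - (f x + (y - x) *\<^sub>R D))"
      by (simp add: scaleR_diff_right scaleR_add_right)
    then show "norm ((1 / norm (y - x)) *\<^sub>R (f y - (f x + (y - x) *\<^sub>R D)))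
      = norm (inverse (y - x) *\<^sub>R (f y - f x) - D)"
      by (simp add: divide_inverse)
  qed
  have "((\<lambda>y. norm (inverse (y - x) *\<^sub>R (f y - f x) - D)) \<longlongrightarrow> 0) (at x within S)"
    by (rule Lim_transform_eventually[OF tendsto_norm_zero[OF lim] ev])
  then show ?thesis
    by (metis LIM_zero_cancel tendsto_norm_zero_cancel)
qed

lemma tendsto_norm_difference_quotient:
  assumes "(f has_vector_derivative D) (at x within S)"
  shows "((\<lambda>y. norm (f y - f x) / \<bar>y - x\<bar>) \<longlongrightarrow> norm D) (at x within S)"
  using tendsto_norm[OF tendsto_difference_quotient[OF assms]] by (simp add: divide_inverse mult.commute)

lemma constant_on_Jint:
  assumes "\<And>s. s \<in> Jint l \<Longrightarrow> (f has_vector_derivative 0) (at s within Jint l)"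
    and "s \<in> Jint l" "t \<in> Jint l"
  shows "f s = f t"
proof -
  have "convex (Jint l)" by (simp add: Jint_def)
  then obtain k where "\<And>x. x \<in> Jint l \<Longrightarrow> f x = k"
    using has_vector_derivative_zero_constant assms(1) by blast
  then show ?thesis using assms by metis
qed

lemma uminus_mem_Jint: "- s \<in> Jint l \<longleftrightarrow> s \<in> Jint l"
  by (auto simp: Jint_def)

text \<open>The parameter change \<phi> from f to g is continuous and injective, hence monotone, and
  the unit speeds force its difference quotients to 1 in absolute value. So \<phi> is affine with
  slope 1 or -1, and it maps \<open>Jint l\<close> into itself. Differentiability of \<phi> is
  derived, not presupposed.\<close>

lemma unit_speed_same_image:
  fixes f g :: "real \<Rightarrow> 'a::real_normed_vector"
  assumes l: "l > 0"
    and f: "\<And>s. s \<in> Jint l \<Longrightarrow> (f has_vector_derivative f' s) (at s within Jint l)"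
    and g: "\<And>s. s \<in> Jint l \<Longrightarrow> (g has_vector_derivative g' s) (at s within Jint l)"
    and nf: "\<And>s. s \<in> Jint l \<Longrightarrow> norm (f' s) = 1" and ng: "\<And>s. s \<in> Jint l \<Longrightarrow> norm (g' s) = 1"
    and inj: "inj_on f (Jint l)" "inj_on g (Jint l)" and im: "f ` Jint l = g ` Jint l"
  shows "(\<forall>s\<in>Jint l. f s = g s) \<or> (\<forall>s\<in>Jint l. f s = g (- s))"
proof -
  let ?J = "Jint l"
  define \<phi> where "\<phi> s = inv_into ?J g (f s)" for s
  have \<phi>: "\<phi> s \<in> ?J" "g (\<phi> s) = f s" if "s \<in> ?J" for s
    using that im by (auto simp: \<phi>_def intro!: inv_into_into f_inv_into_f)
  have cf: "continuous_on ?J f" and cg: "continuous_on ?J g"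
    using f g has_vector_derivative_continuous unfolding continuous_on_eq_continuous_within by blast+
  have "continuous_on (g ` ?J) (inv_into ?J g)"
    by (rule continuous_on_inv[OF cg compact_Jint]) (auto simp: inj(2))
  then have c\<phi>: "continuous_on ?J \<phi>"
    unfolding \<phi>_def by (rule continuous_on_compose2[OF _ cf]) (use im in auto)
  have inj\<phi>: "inj_on \<phi> ?J"
    using \<phi> inj(1) by (metis inj_on_def)
  \<comment> \<open>Since g (\<phi> y) = f y, the chords of f and g have the same length; it cancels
    in the quotient of the two chord ratios, each of which tends to 1.\<close>
  have quot: "((\<lambda>y. \<bar>\<phi> y - \<phi> s\<bar> / \<bar>y - s\<bar>) \<longlongrightarrow> 1) (at s within ?J)" if s: "s \<in> ?J" for s
  proof -
    have "(\<phi> \<longlongrightarrow> \<phi> s) (at s within ?J)"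
      using c\<phi> s by (simp add: continuous_on)
    moreover have ev: "\<forall>\<^sub>F y in at s within ?J. \<phi> y \<in> ?J \<and> \<phi> y \<noteq> \<phi> s \<and> y \<in> ?J \<and> y \<noteq> s"
      unfolding eventually_at_filter
      using \<phi>(1) inj_onD[OF inj\<phi> _ _ s] by (intro always_eventually) blast
    ultimately have lim: "filterlim \<phi> (at (\<phi> s) within ?J) (at s within ?J)"
      by (auto simp: filterlim_at elim!: eventually_mono)
    have 1: "((\<lambda>y. norm (g (\<phi> y) - g (\<phi> s)) / \<bar>\<phi> y - \<phi> s\<bar>) \<longlongrightarrow> 1) (at s within ?J)"
      using filterlim_compose[OF tendsto_norm_difference_quotient[OF g[OF \<phi>(1)[OF s]]] lim] ng[OF \<phi>(1)[OF s]]
      by simp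
    have 2: "((\<lambda>y. norm (f y - f s) / \<bar>y - s\<bar>) \<longlongrightarrow> 1) (at s within ?J)"
      using tendsto_norm_difference_quotient[OF f[OF s]] nf[OF s] by simp
    have "((\<lambda>y. (norm (f y - f s) / \<bar>y - s\<bar>) / (norm (g (\<phi> y) - g (\<phi> s)) / \<bar>\<phi> y - \<phi> s\<bar>)) \<longlongrightarrow> 1) (at s within ?J)"
      using tendsto_divide[OF 2 1] by simp
    moreover have "\<forall>\<^sub>F y in at s within ?J.
        (norm (f y - f s) / \<bar>y - s\<bar>) / (norm (g (\<phi> y) - g (\<phi> s)) / \<bar>\<phi> y - \<phi> s\<bar>) = \<bar>\<phi> y - \<phi> s\<bar> / \<bar>y - s\<bar>"
      using ev
    proof eventually_elim
      case (elim y)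
      then have "norm (f y - f s) \<noteq> 0" using inj(1) s by (auto dest: inj_onD)
      then show ?case using elim \<phi>(2) s by (simp add: field_simps)
    qed
    ultimately show ?thesis by (rule Lim_transform_eventually)
  qed
  have ends: "l/2 \<in> ?J" "-l/2 \<in> ?J" using l by (auto simp: Jint_def)
  have bd: "\<phi> (l/2) \<le> l/2" "\<phi> (l/2) \<ge> -l/2" "\<phi> (-l/2) \<le> l/2" "\<phi> (-l/2) \<ge> -l/2"
    using \<phi>(1)[OF ends(1)] \<phi>(1)[OF ends(2)] by (auto simp: Jint_def)
  \<comment> \<open>\<sigma> is the sign that monotonicity gives to all difference quotients. It
    turns the limit of the absolute quotients into a genuine derivative \<sigma>.\<close>
  have affine: "\<phi> s - \<sigma> * s = \<phi> t - \<sigma> * t"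
    if sg: "\<forall>s\<in>?J. \<forall>y\<in>?J. y \<noteq> s \<longrightarrow> (\<phi> y - \<phi> s) / (y - s) = \<sigma> * (\<bar>\<phi> y - \<phi> s\<bar> / \<bar>y - s\<bar>)"
      and st: "s \<in> ?J" "t \<in> ?J" for \<sigma> s t
  proof (rule constant_on_Jint[of l "\<lambda>s. \<phi> s - \<sigma> * s"])
    fix s assume s: "s \<in> ?J"
    have "((\<lambda>y. \<sigma> * (\<bar>\<phi> y - \<phi> s\<bar> / \<bar>y - s\<bar>)) \<longlongrightarrow> \<sigma>) (at s within ?J)"
      using tendsto_mult_left[OF quot[OF s], of \<sigma>] by simp
    moreover have "\<forall>\<^sub>F y in at s within ?J. \<sigma> * (\<bar>\<phi> y - \<phi> s\<bar> / \<bar>y - s\<bar>) = (\<phi> y - \<phi> s) / (y - s)"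
      unfolding eventually_at_filter
      using sg s by (intro always_eventually) metis
    ultimately have "((\<lambda>y. (\<phi> y - \<phi> s) / (y - s)) \<longlongrightarrow> \<sigma>) (at s within ?J)"
      by (rule Lim_transform_eventually)
    then have "(\<phi> has_field_derivative \<sigma>) (at s within ?J)"
      by (simp add: has_field_derivative_iff)
    then have "((\<lambda>s. \<phi> s - \<sigma> * s) has_field_derivative 0) (at s within ?J)"
      by (auto intro!: derivative_eq_intros)
    then show "((\<lambda>s. \<phi> s - \<sigma> * s) has_vector_derivative 0) (at s within ?J)"
      by (simp add: has_real_derivative_iff_has_vector_derivative)
  qed (use st in auto)
  consider "strict_mono_on ?J \<phi>" | "strict_antimono_on ?J \<phi>"
    using injective_eq_monotone_map[of ?J \<phi>] c\<phi> inj\<phi> by (auto simp: Jint_def)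
  then show ?thesis
  proof cases
    case 1
    have sg: "(\<phi> y - \<phi> s) / (y - s) = 1 * (\<bar>\<phi> y - \<phi> s\<bar> / \<bar>y - s\<bar>)" if "s \<in> ?J" "y \<in> ?J" "y \<noteq> s" for s y
      using that strict_mono_onD[OF 1, of s y] strict_mono_onD[OF 1, of y s] by (cases "s < y") (auto simp: abs_if field_simps)
    have aff: "\<phi> s - 1 * s = \<phi> t - 1 * t" if "s \<in> ?J" "t \<in> ?J" for s t
      by (rule affine[OF _ that]) (use sg in blast)
    \<comment> \<open>The constant \<phi> s - s is at most 0 at the right endpoint and at least 0 at
      the left one.\<close>
    have "\<phi> s = s" if "s \<in> ?J" for s
      using aff[OF that ends(1)] aff[OF that ends(2)] bd by auto
    then show ?thesis using \<phi>(2) by metis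
  next
    case 2
    have sg: "(\<phi> y - \<phi> s) / (y - s) = (-1) * (\<bar>\<phi> y - \<phi> s\<bar> / \<bar>y - s\<bar>)" if "s \<in> ?J" "y \<in> ?J" "y \<noteq> s" for s y
      using that monotone_onD[OF 2, of s y] monotone_onD[OF 2, of y s] by (cases "s < y") (auto simp: abs_if field_simps)
    have aff: "\<phi> s - (-1) * s = \<phi> t - (-1) * t" if "s \<in> ?J" "t \<in> ?J" for s t
      by (rule affine[OF _ that]) (use sg in blast)
    have "\<phi> s = - s" if "s \<in> ?J" for s
      using aff[OF that ends(1)] aff[OF that ends(2)] bd by auto
    then show ?thesis using \<phi>(2) by metis
  qed
qed

section \<open>Symmetries of plane arcs\<close>

definition rot90 :: "real^2 \<Rightarrow> real^2" where
  "rot90 x = vector [- (x $ 2), x $ 1]"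

lemma rot90_simps [simp]: "rot90 x $ 1 = - (x $ 2)" "rot90 x $ 2 = x $ 1"
  by (simp_all add: rot90_def)

lemma linear_rot90: "linear rot90"
  by (rule linearI) (auto simp: vec_eq_iff forall_2)

lemmas rot90_add = linear_add[OF linear_rot90] and rot90_diff = linear_diff[OF linear_rot90]
  and rot90_scaleR = linear_scale[OF linear_rot90]

lemma inner_rot90 [simp]: "x \<bullet> rot90 x = 0" "rot90 x \<bullet> rot90 y = x \<bullet> y"
  by (simp_all add: inner_vec_def sum_2)

lemma rot90_expansion:
  assumes "norm a = 1"
  shows "x = (x \<bullet> a) *\<^sub>R a + (x \<bullet> rot90 a) *\<^sub>R rot90 a"
proof -
  have a: "a $ 1 * a $ 1 + a $ 2 * a $ 2 = 1"
    using assms by (simp add: norm_eq_1 inner_vec_def sum_2)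
  have "x $ 1 = x $ 1 * (a $ 1 * a $ 1 + a $ 2 * a $ 2)" "x $ 2 = x $ 2 * (a $ 1 * a $ 1 + a $ 2 * a $ 2)"
    by (simp_all add: a)
  then show ?thesis
    by (simp add: vec_eq_iff forall_2 inner_vec_def sum_2 algebra_simps)
qed

context
  fixes l :: real and I :: "real set" and \<gamma> :: "real \<Rightarrow> real^2"
  assumes l: "l > 0" and I: "open I" and JI: "Jint l \<subseteq> I" and \<gamma>: "Cinf_on I \<gamma>"
    and unit: "\<And>s. s \<in> Jint l \<Longrightarrow> norm (d1 \<gamma> s) = 1" and inj: "inj_on \<gamma> (Jint l)"
    and curved: "\<And>s. s \<in> Jint l \<Longrightarrow> plane_curv \<gamma> s > 0"
begin

private lemma d\<gamma>: "s \<in> Jint l \<Longrightarrow> (\<gamma> has_vector_derivative d1 \<gamma> s) (at s)"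
  and d\<gamma>': "s \<in> Jint l \<Longrightarrow> (d1 \<gamma> has_vector_derivative d2 \<gamma> s) (at s)"
  using Cinf_on_d1(2)[OF I \<gamma>] Cinf_on_d2(2)[OF I \<gamma>] JI by blast+

text \<open>The coefficient is the signed curvature. Signs matter for the symmetry argument, whereas
  \<open>plane_curv\<close>, being a norm, retains only its absolute value.\<close>

private lemma d2_eq_rot90:
  assumes "s \<in> Jint l"
  shows "d2 \<gamma> s = (d2 \<gamma> s \<bullet> rot90 (d1 \<gamma> s)) *\<^sub>R rot90 (d1 \<gamma> s)"
  using rot90_expansion[OF unit[OF assms], of "d2 \<gamma> s"] d1_orthogonal_d2[OF l I JI \<gamma> unit assms]
  by (simp add: inner_commute)

private lemma abs_signed_curv:
  assumes "s \<in> Jint l"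
  shows "\<bar>d2 \<gamma> s \<bullet> rot90 (d1 \<gamma> s)\<bar> = plane_curv \<gamma> s"
proof -
  have "norm (rot90 (d1 \<gamma> s)) = 1"
    using unit[OF assms] by (simp add: norm_eq_1)
  then show ?thesis
    using arg_cong[OF d2_eq_rot90[OF assms], of norm] by (simp add: plane_curv_def)
qed

text \<open>A symmetry T has an orthogonal linear part L and carries \<gamma> to a unit speed
  parametrization of the same arc, namely \<gamma> or its reversal. In the first case L fixes the
  tangent and, the curvature being nonzero, also the normal, so that T would be the identity. In the
  second case L maps \<gamma>'' at s to \<gamma>'' at -s and preserves norms.\<close>

lemma has_symmetry_imp_curv_even:
  assumes "has_symmetry (\<gamma> ` Jint l)" and s: "s \<in> Jint l"
  shows "plane_curv \<gamma> (- s) = plane_curv \<gamma> s"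
proof -
  obtain T where T: "\<And>x y. dist (T x) (T y) = dist x y" "T \<noteq> id" "T ` \<gamma> ` Jint l = \<gamma> ` Jint l"
    using assms(1) unfolding has_symmetry_def by blast
  define L where "L x = T x - T 0" for x
  have "orthogonal_transformation L"
    unfolding orthogonal_transformation_isometry using T(1) by (simp add: L_def dist_norm)
  then have lin: "linear L" and nL: "\<And>x. norm (L x) = norm x"
    by (auto simp: orthogonal_transformation)
  have bl: "bounded_linear L" using lin by (simp add: linear_conv_bounded_linear)
  note dL = bounded_linear.has_vector_derivative[OF bl]
  have Tx: "T x = L x + T 0" for x by (simp add: L_def)
  have dT: "((\<lambda>s. T (\<gamma> s)) has_vector_derivative L (d1 \<gamma> s)) (at s within Jint l)" if "s \<in> Jint l" for s
    using has_vector_derivative_add[OF dL[OF has_vector_derivative_at_within[OF d\<gamma>[OF that]]]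
        has_vector_derivative_const[of "T 0"]]
    by (simp flip: Tx)
  have "inj_on (\<lambda>s. T (\<gamma> s)) (Jint l)"
    using inj T(1) unfolding inj_on_def by (metis dist_eq_0_iff)
  then consider "\<forall>s\<in>Jint l. T (\<gamma> s) = \<gamma> s" | "\<forall>s\<in>Jint l. T (\<gamma> s) = \<gamma> (- s)"
    using unit_speed_same_image[of l "\<lambda>s. T (\<gamma> s)" "\<lambda>s. L (d1 \<gamma> s)" \<gamma> "d1 \<gamma>"]
      l dT has_vector_derivative_at_within[OF d\<gamma>] T(3) inj unit nL
    by (force simp: image_image)
  then show ?thesis
  proof cases
    case 1
    have L1: "L (d1 \<gamma> s) = d1 \<gamma> s" if "s \<in> Jint l" for s
      using Jint_unique_derivative[OF l that, of "\<lambda>s. T (\<gamma> s)" \<gamma>] 1 dT[OF that]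
        has_vector_derivative_at_within[OF d\<gamma>[OF that]] by blast
    have L2: "L (d2 \<gamma> s) = d2 \<gamma> s"
      using Jint_unique_derivative[OF l s, of "\<lambda>s. L (d1 \<gamma> s)" "d1 \<gamma>"] L1
        dL[OF has_vector_derivative_at_within[OF d\<gamma>'[OF s]]] has_vector_derivative_at_within[OF d\<gamma>'[OF s]] by blast
    let ?k = "d2 \<gamma> s \<bullet> rot90 (d1 \<gamma> s)"
    have "?k *\<^sub>R L (rot90 (d1 \<gamma> s)) = ?k *\<^sub>R rot90 (d1 \<gamma> s)"
      using L2 d2_eq_rot90[OF s] linear_scale[OF lin] by metis
    then have L3: "L (rot90 (d1 \<gamma> s)) = rot90 (d1 \<gamma> s)"
      using abs_signed_curv[OF s] curved[OF s] by auto
    have Lid: "L x = x" for x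
      using rot90_expansion[OF unit[OF s], of x] linear_add[OF lin] linear_scale[OF lin] L1[OF s] L3 by metis
    have "T 0 = 0" using 1 s Tx Lid by (metis add_cancel_right_right)
    then have "T x = x" for x using Tx[of x] Lid[of x] by simp
    then show ?thesis using T(2) by (simp add: fun_eq_iff)
  next
    case 2
    have L1: "L (d1 \<gamma> s) = - d1 \<gamma> (- s)" if "s \<in> Jint l" for s
      using Jint_unique_derivative[OF l that, of "\<lambda>s. T (\<gamma> s)" "\<lambda>s. \<gamma> (- s)"] 2 dT[OF that]
        has_vector_derivative_reflect[OF d\<gamma>] that by (simp add: uminus_mem_Jint)
    have "((\<lambda>s. - d1 \<gamma> (- s)) has_vector_derivative - (- d2 \<gamma> (- s))) (at s within Jint l)"
      using s by (intro has_vector_derivative_minus has_vector_derivative_reflect d\<gamma>') (simp add: uminus_mem_Jint)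
    then have "L (d2 \<gamma> s) = d2 \<gamma> (- s)"
      using Jint_unique_derivative[OF l s, of "\<lambda>s. L (d1 \<gamma> s)" "\<lambda>s. - d1 \<gamma> (- s)"] L1
        dL[OF has_vector_derivative_at_within[OF d\<gamma>'[OF s]]] by simp
    then show ?thesis by (metis nL plane_curv_def)
  qed
qed

text \<open>An even curvature function makes the reflection in the normal line at the midpoint
  reverse the curve: the reflected and the reversed tangent solve the same linear
  differential equation.\<close>

lemma curv_even_imp_has_symmetry:
  assumes even: "\<And>s. s \<in> Jint l \<Longrightarrow> plane_curv \<gamma> (- s) = plane_curv \<gamma> s"
  shows "has_symmetry (\<gamma> ` Jint l)"
proof -
  have J0: "0 \<in> Jint l" using l by (simp add: Jint_def)
  define k where "k s = d2 \<gamma> s \<bullet> rot90 (d1 \<gamma> s)" for s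
  have blr: "bounded_linear rot90" using linear_rot90 by (simp add: linear_conv_bounded_linear)
  have "continuous_on (Jint l) k"
    unfolding k_def
    by (intro continuous_on_inner bounded_linear.continuous_on[OF blr]
        continuous_on_subset[OF Cinf_on_continuous[OF Cinf_on_d2(1)[OF I \<gamma>]] JI]
        continuous_on_subset[OF Cinf_on_continuous[OF Cinf_on_d1(1)[OF I \<gamma>]] JI])
  then have conn: "connected (k ` Jint l)"
    by (rule connected_continuous_image) (simp add: Jint_def)
  have kabs: "\<bar>k s\<bar> = plane_curv \<gamma> s" if "s \<in> Jint l" for s
    using abs_signed_curv[OF that] by (simp add: k_def)
  \<comment> \<open>The hypothesis gives only equal absolute values. Opposite signs would produce a
    zero of k by connectedness, against positive curvature.\<close>
  have keven: "k (- s) = k s" if s: "s \<in> Jint l" for s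
  proof (rule ccontr)
    assume ne: "k (- s) \<noteq> k s"
    have ms: "- s \<in> Jint l" using s by (simp add: uminus_mem_Jint)
    have eq: "k (- s) = - k s"
      using ne kabs[OF s] kabs[OF ms] even[OF s] by (auto simp: abs_if split: if_splits)
    have "0 \<in> k ` Jint l"
      using connected_contains_Icc[OF conn imageI[OF s] imageI[OF ms]]
        connected_contains_Icc[OF conn imageI[OF ms] imageI[OF s]] eq by (cases "k s \<le> 0") auto
    then show False using kabs curved by force
  qed
  define a where "a = d1 \<gamma> 0"
  have a: "norm a = 1" using unit[OF J0] by (simp add: a_def)
  define L where "L v = v - (2 * (v \<bullet> a)) *\<^sub>R a" for v
  have lin: "linear L"
    by (rule linearI) (auto simp: L_def algebra_simps)
  have bl: "bounded_linear L" using lin by (simp add: linear_conv_bounded_linear)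
  note dL = bounded_linear.has_vector_derivative[OF bl]
  have nL: "norm (L v) = norm v" for v
    using a by (simp add: L_def norm_eq_sqrt_inner algebra_simps power2_eq_square inner_commute)
  \<comment> \<open>A reflection reverses orientation and hence anticommutes with the quarter
    turn.\<close>
  have Lrot: "L (rot90 v) = - rot90 (L v)" for v
  proof -
    have "rot90 v = (rot90 v \<bullet> a) *\<^sub>R a + (v \<bullet> a) *\<^sub>R rot90 a"
      using rot90_expansion[OF a, of "rot90 v"] by simp
    then have "rot90 v - ((rot90 v \<bullet> a) *\<^sub>R a + (v \<bullet> a) *\<^sub>R rot90 a) = 0" by simp
    moreover have "L (rot90 v) + rot90 (L v) = 2 *\<^sub>R (rot90 v - ((rot90 v \<bullet> a) *\<^sub>R a + (v \<bullet> a) *\<^sub>R rot90 a))"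
      by (simp add: L_def rot90_diff rot90_scaleR scaleR_diff_right scaleR_add_right scaleR_2)
    ultimately show ?thesis by (simp add: eq_neg_iff_add_eq_0)
  qed
  \<comment> \<open>D measures the failure of L to send the tangent at s to minus the tangent at -s.
    It satisfies D' = -k \<open>rot90\<close> D, so D' is orthogonal to D, |D| is constant, and D =
    0 because L negates the tangent at 0. No uniqueness theorem for differential equations is
    involved.\<close>
  define D where "D s = L (d1 \<gamma> s) + d1 \<gamma> (- s)" for s
  have dD: "(D has_vector_derivative (- k s) *\<^sub>R rot90 (D s)) (at s within Jint l)" if s: "s \<in> Jint l" for s
  proof -
    have ms: "- s \<in> Jint l" using s by (simp add: uminus_mem_Jint)
    have "(D has_vector_derivative L (d2 \<gamma> s) + - d2 \<gamma> (- s)) (at s within Jint l)"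
      unfolding D_def[abs_def]
      by (intro has_vector_derivative_add dL has_vector_derivative_reflect has_vector_derivative_at_within[OF d\<gamma>'[OF s]] d\<gamma>'[OF ms])
    moreover have "L (d2 \<gamma> s) = (- k s) *\<^sub>R rot90 (L (d1 \<gamma> s))"
      by (subst d2_eq_rot90[OF s]) (simp add: linear_scale[OF lin] Lrot k_def)
    moreover have "d2 \<gamma> (- s) = k s *\<^sub>R rot90 (d1 \<gamma> (- s))"
      by (subst d2_eq_rot90[OF ms]) (simp flip: k_def add: keven[OF s])
    ultimately show ?thesis
      by (simp add: D_def rot90_add scaleR_add_right)
  qed
  have "D s \<bullet> D s = D 0 \<bullet> D 0" if s: "s \<in> Jint l" for s
  proof (rule constant_on_Jint[OF _ s J0])
    fix s assume "s \<in> Jint l"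
    from bounded_bilinear.has_vector_derivative[OF bounded_bilinear_inner dD[OF this] dD[OF this]]
    show "((\<lambda>s. D s \<bullet> D s) has_vector_derivative 0) (at s within Jint l)"
      by (simp add: inner_commute[of "rot90 (D s)"])
  qed
  moreover have "D 0 = 0"
    using a by (simp add: D_def L_def a_def norm_eq_1 scaleR_2)
  ultimately have D0: "D s = 0" if "s \<in> Jint l" for s
    using that by simp
  define T where "T x = L (x - \<gamma> 0) + \<gamma> 0" for x
  have T\<gamma>: "T (\<gamma> s) = \<gamma> (- s)" if s: "s \<in> Jint l" for s
  proof -
    have "T (\<gamma> s) - \<gamma> (- s) = T (\<gamma> 0) - \<gamma> (- 0)"
    proof (rule constant_on_Jint[OF _ s J0])
      fix s assume s: "s \<in> Jint l"
      have ms: "- s \<in> Jint l" using s by (simp add: uminus_mem_Jint)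
      have "((\<lambda>s. L (\<gamma> s - \<gamma> 0) + \<gamma> 0 - \<gamma> (- s)) has_vector_derivative (L (d1 \<gamma> s - 0) + 0) - (- d1 \<gamma> (- s))) (at s within Jint l)"
        by (intro has_vector_derivative_diff has_vector_derivative_add dL has_vector_derivative_reflect has_vector_derivative_const
            has_vector_derivative_at_within[OF d\<gamma>[OF s]] d\<gamma>[OF ms])
      then show "((\<lambda>s. T (\<gamma> s) - \<gamma> (- s)) has_vector_derivative 0) (at s within Jint l)"
        using D0[OF s] by (simp add: T_def D_def)
    qed
    then show ?thesis by (simp add: T_def linear_0[OF lin])
  qed
  have "uminus ` Jint l = Jint l" by (force simp: uminus_mem_Jint image_iff intro: bexI[of _ "- _"])
  then have "T ` \<gamma> ` Jint l = \<gamma> ` Jint l"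
    using T\<gamma> by (metis (no_types, lifting) image_cong image_image)
  moreover have "dist (T x) (T y) = dist x y" for x y
    using nL[of "x - y"] by (simp add: T_def dist_norm flip: linear_diff[OF lin])
  moreover have "T \<noteq> id"
  proof
    assume "T = id"
    then have "T (\<gamma> 0 + a) = \<gamma> 0 + a" by simp
    then have "L a = a" by (simp add: T_def)
    then have "(2 * (a \<bullet> a)) *\<^sub>R a = 0" by (simp add: L_def)
    then show False using a by auto
  qed
  ultimately show ?thesis unfolding has_symmetry_def by blast
qed

end

section \<open>Germs of curved foldings\<close>

lemma germ_eq_iff: "germ A = germ B \<longleftrightarrow> (\<exists>\<epsilon>0>0. \<forall>\<epsilon>. 0 < \<epsilon> \<and> \<epsilon> < \<epsilon>0 \<longrightarrow> A \<epsilon> = B \<epsilon>)"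
proof
  assume "germ A = germ B"
  moreover have "A \<in> germ A" by (auto simp: germ_def intro: exI[of _ 1])
  ultimately show "\<exists>\<epsilon>0>0. \<forall>\<epsilon>. 0 < \<epsilon> \<and> \<epsilon> < \<epsilon>0 \<longrightarrow> A \<epsilon> = B \<epsilon>" by (auto simp: germ_def)
next
  assume "\<exists>\<epsilon>0>0. \<forall>\<epsilon>. 0 < \<epsilon> \<and> \<epsilon> < \<epsilon>0 \<longrightarrow> A \<epsilon> = B \<epsilon>"
  then obtain e where e: "e > 0" "\<And>\<epsilon>. 0 < \<epsilon> \<Longrightarrow> \<epsilon> < e \<Longrightarrow> A \<epsilon> = B \<epsilon>" by blast
  have "(\<exists>\<epsilon>0>0. \<forall>\<epsilon>. 0 < \<epsilon> \<and> \<epsilon> < \<epsilon>0 \<longrightarrow> X \<epsilon> = A \<epsilon>) \<longleftrightarrow> (\<exists>\<epsilon>0>0. \<forall>\<epsilon>. 0 < \<epsilon> \<and> \<epsilon> < \<epsilon>0 \<longrightarrow> X \<epsilon> = B \<epsilon>)" for X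
  proof (intro iffI; elim exE conjE)
    fix d assume "d > 0" "\<forall>\<epsilon>. 0 < \<epsilon> \<and> \<epsilon> < d \<longrightarrow> X \<epsilon> = A \<epsilon>"
    then show "\<exists>\<epsilon>0>0. \<forall>\<epsilon>. 0 < \<epsilon> \<and> \<epsilon> < \<epsilon>0 \<longrightarrow> X \<epsilon> = B \<epsilon>"
      using e by (intro exI[of _ "min d e"]) simp
  next
    fix d assume "d > 0" "\<forall>\<epsilon>. 0 < \<epsilon> \<and> \<epsilon> < d \<longrightarrow> X \<epsilon> = B \<epsilon>"
    then show "\<exists>\<epsilon>0>0. \<forall>\<epsilon>. 0 < \<epsilon> \<and> \<epsilon> < \<epsilon>0 \<longrightarrow> X \<epsilon> = A \<epsilon>"
      using e by (intro exI[of _ "min d e"]) simp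
  qed
  then show "germ A = germ B" by (simp add: germ_def)
qed

text \<open>Fixes the parametrized crease c and forgets the neighbourhood, so that strips with
  different domains, reversed strips included, can be compared over the same c.\<close>

definition strip_along :: "real \<Rightarrow> (real \<Rightarrow> real^3) \<Rightarrow> (real \<times> real \<Rightarrow> real^3) \<Rightarrow> bool" where
  "strip_along l c F \<longleftrightarrow> (\<exists>C I \<delta>. strip_on l C F I \<delta>) \<and> normalized l F \<and> (\<forall>s\<in>Jint l. base F s = c s)"

lemma strip_along_linear:
  assumes "strip_along l c F"
  shows "\<exists>\<delta>>0. \<forall>s\<in>Jint l. \<forall>v. \<bar>v\<bar> < \<delta> \<longrightarrow> F (s, v) = c s + v *\<^sub>R rul F s"
proof -
  obtain C I \<delta> where st: "strip_on l C F I \<delta>" and b: "\<forall>s\<in>Jint l. base F s = c s"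
    using assms unfolding strip_along_def by blast
  then show ?thesis
    using strip_onD(3)[OF st] strip_onD(6,13)[OF st] by metis
qed

lemma strip_along_continuous_rul:
  assumes "strip_along l c F"
  shows "continuous_on (Jint l) (rul F)"
  using assms strip_onD(2,5) unfolding strip_along_def
  by (meson Cinf_on_continuous continuous_on_subset)

lemma strip_along_norm_rul:
  assumes "strip_along l c F" "s \<in> Jint l"
  shows "norm (rul F s) = 1"
  using assms strip_onD(8,13) unfolding strip_along_def by blast

lemma strip_along_frame:
  assumes l: "l > 0" and I: "open I" and JI: "Jint l \<subseteq> I" and c: "Cinf_on I c"
    and H: "strip_along l c H" and s: "s \<in> Jint l"
  shows "d1 (base H) s = d1 c s" "d2 (base H) s = d2 c s" "rul H s \<bullet> d2 c s > 0"
    "tan (angle1 H s) = (rul H s \<bullet> cross3 (d1 c s) (d2 c s)) / (rul H s \<bullet> d2 c s)"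
proof -
  obtain C' I' \<delta>' where st: "strip_on l C' H I' \<delta>'" and n: "normalized l H"
    and bs: "\<And>s. s \<in> Jint l \<Longrightarrow> base H s = c s"
    using H unfolding strip_along_def by blast
  show d: "d1 (base H) s = d1 c s" "d2 (base H) s = d2 c s"
    using d1_eq_on_Jint[OF l strip_onD(1)[OF st] I strip_onD(2)[OF st] JI strip_onD(4)[OF st] c _ s]
      d2_eq_on_Jint[OF l strip_onD(1)[OF st] I strip_onD(2)[OF st] JI strip_onD(4)[OF st] c _ s] bs by blast+
  show "rul H s \<bullet> d2 c s > 0" using normalizedD[OF n s] d by simp
  show "tan (angle1 H s) = (rul H s \<bullet> cross3 (d1 c s) (d2 c s)) / (rul H s \<bullet> d2 c s)"
    using tan_angle1[OF curv_nonzero_on_normalized[OF n s]] d by simp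
qed

text \<open>For small v a strip is linear in v, and the folded image uses only s in
  \<open>Jint l\<close>; there the crease and the rulings determine everything.\<close>

lemma germ_origami_cong:
  assumes F: "strip_along l c F" "strip_along l c F'" "\<And>s. s \<in> Jint l \<Longrightarrow> rul F s = rul F' s"
    and G: "strip_along l c G" "strip_along l c G'" "\<And>s. s \<in> Jint l \<Longrightarrow> rul G s = rul G' s"
  shows "germ (origami_image l F G) = germ (origami_image l F' G')"
proof -
  have "\<exists>d>0. \<forall>s\<in>Jint l. \<forall>v. \<bar>v\<bar> < d \<longrightarrow> H (s, v) = H' (s, v)"
    if H: "strip_along l c H" "strip_along l c H'" "\<And>s. s \<in> Jint l \<Longrightarrow> rul H s = rul H' s" for H H'
  proof -
    obtain d d' where "d > 0" "\<forall>s\<in>Jint l. \<forall>v. \<bar>v\<bar> < d \<longrightarrow> H (s, v) = c s + v *\<^sub>R rul H s"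
      "d' > 0" "\<forall>s\<in>Jint l. \<forall>v. \<bar>v\<bar> < d' \<longrightarrow> H' (s, v) = c s + v *\<^sub>R rul H' s"
      using strip_along_linear[OF H(1)] strip_along_linear[OF H(2)] by blast
    then show ?thesis using H(3) by (intro exI[of _ "min d d'"]) simp
  qed
  from this[OF F] this[OF G] obtain d e where d: "d > 0" "\<forall>s\<in>Jint l. \<forall>v. \<bar>v\<bar> < d \<longrightarrow> F (s, v) = F' (s, v)"
    and e: "e > 0" "\<forall>s\<in>Jint l. \<forall>v. \<bar>v\<bar> < e \<longrightarrow> G (s, v) = G' (s, v)" by blast
  have "origami_image l F G \<epsilon> = origami_image l F' G' \<epsilon>" if "\<epsilon> < min d e" for \<epsilon>
    unfolding origami_image_def by (rule image_cong) (use that d e in auto)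
  then show ?thesis
    unfolding germ_eq_iff using d(1) e(1) by (intro exI[of _ "min d e"]) simp
qed

text \<open>The point \<open>c s + v \<xi>(s)\<close> of the first folding lies on the second one at distance
  \<open>O(v)\<close> from the crease; letting \<open>v\<close> tend to 0 shows that the ruling of the first
  folding is tangent to the second one, and the sign of its normal component
  singles out the half of the second folding on the side of the principal normal.\<close>

lemma germ_eq_imp_tan_angle1_eq:
  assumes l: "l > 0" and I: "open I" and JI: "Jint l \<subseteq> I" and c: "Cinf_on I c"
    and unit: "\<And>s. s \<in> Jint l \<Longrightarrow> norm (d1 c s) = 1" and inj: "inj_on c (Jint l)"
    and F: "strip_along l c F" and F': "strip_along l c F'" and G': "strip_along l c G'"
    and eq: "germ (origami_image l F G) = germ (origami_image l F' G')" and s: "s \<in> Jint l"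
  shows "tan (angle1 F s) = tan (angle1 F' s)"
proof -
  let ?J = "Jint l"
  obtain \<epsilon>0 where \<epsilon>0: "\<epsilon>0 > 0" "\<And>\<epsilon>. 0 < \<epsilon> \<Longrightarrow> \<epsilon> < \<epsilon>0 \<Longrightarrow> origami_image l F G \<epsilon> = origami_image l F' G' \<epsilon>"
    using eq unfolding germ_eq_iff by blast
  obtain d where d: "d > 0" "\<forall>s\<in>Jint l. \<forall>v. \<bar>v\<bar> < d \<longrightarrow> F (s, v) = c s + v *\<^sub>R rul F s"
    using strip_along_linear[OF F] by blast
  obtain d' where d': "d' > 0" "\<forall>s\<in>Jint l. \<forall>v. \<bar>v\<bar> < d' \<longrightarrow> F' (s, v) = c s + v *\<^sub>R rul F' s"
    using strip_along_linear[OF F'] by blast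
  obtain e' where e': "e' > 0" "\<forall>s\<in>Jint l. \<forall>v. \<bar>v\<bar> < e' \<longrightarrow> G' (s, v) = c s + v *\<^sub>R rul G' s"
    using strip_along_linear[OF G'] by blast
  define r where "r = min (min \<epsilon>0 d) (min d' e')"
  have r: "r > 0" "r \<le> \<epsilon>0" "r \<le> d" "r \<le> d'" "r \<le> e'" using \<epsilon>0 d d' e' by (auto simp: r_def)
  \<comment> \<open>The images are compared at width 2 v k, which puts (s, v k) strictly inside; the
    factor r/3 keeps this width below r.\<close>
  define v where "v k = (r / 3) * inverse (real (Suc k))" for k
  have v0: "v k > 0" and v2: "2 * v k < r" for k
    using r(1) by (auto simp: v_def field_simps add_pos_nonneg)
  have v_lim: "v \<longlonglongrightarrow> 0"
    using tendsto_mult_left[OF LIMSEQ_inverse_real_of_nat, of "r / 3"] by (simp add: v_def[abs_def])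
  \<comment> \<open>At most one of \<open>max w 0\<close> and \<open>min w 0\<close> is nonzero, so
    one formula covers both halves of the second folding and survives passage to the limit.\<close>
  have "\<exists>t\<in>?J. \<exists>w. \<bar>w\<bar> < 2 * v k \<and>
      c s + v k *\<^sub>R rul F s = c t + max w 0 *\<^sub>R rul F' t + min w 0 *\<^sub>R rul G' t" for k
  proof -
    have "c s + v k *\<^sub>R rul F s = F (s, v k)"
      using d(2) s v0[of k] v2[of k] r by simp
    also have "\<dots> \<in> origami_image l F G (2 * v k)"
      unfolding origami_image_def using s v0[of k] by (intro image_eqI[of _ _ "(s, v k)"]) auto
    also have "\<dots> = origami_image l F' G' (2 * v k)"
      using \<epsilon>0(2) v0[of k] v2[of k] r by simp
    finally obtain z where z: "z \<in> ?J \<times> {- (2 * v k)<..<2 * v k}"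
      and e: "c s + v k *\<^sub>R rul F s = (\<lambda>(s, v). if v \<ge> 0 then F' (s, v) else G' (s, v)) z"
      unfolding origami_image_def by blast
    obtain t w where tw': "z = (t, w)" by (cases z)
    have tw: "t \<in> ?J" "\<bar>w\<bar> < 2 * v k" using z tw' by auto
    have "\<bar>w\<bar> < d'" "\<bar>w\<bar> < e'" using tw(2) v2[of k] r by auto
    then have "(if w \<ge> 0 then F' (t, w) else G' (t, w)) = c t + max w 0 *\<^sub>R rul F' t + min w 0 *\<^sub>R rul G' t"
      using d'(2) e'(2) tw(1) by auto
    then have "c s + v k *\<^sub>R rul F s = c t + max w 0 *\<^sub>R rul F' t + min w 0 *\<^sub>R rul G' t"
      using e tw' by simp
    then show ?thesis using tw by blast
  qed
  then obtain t w where t: "\<And>k. t k \<in> ?J" and w: "\<And>k. \<bar>w k\<bar> < 2 * v k"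
    and tw: "\<And>k. c s + v k *\<^sub>R rul F s = c (t k) + max (w k) 0 *\<^sub>R rul F' (t k) + min (w k) 0 *\<^sub>R rul G' (t k)"
    by metis
  \<comment> \<open>The difference quotient of c at s, completed by c'(s). It is continuous on
    \<open>Jint l\<close>, and nowhere zero by injectivity and unit speed; its positive minimum m
    bounds the coefficients of \<phi> below.\<close>
  define \<phi> where "\<phi> y = (if y = s then d1 c s else inverse (y - s) *\<^sub>R (c y - c s))" for y
  have \<phi>: "c y - c s = (y - s) *\<^sub>R \<phi> y" for y
    by (simp add: \<phi>_def)
  have sI: "s \<in> I" using s JI by blast
  have cc: "continuous_on ?J c"
    using Cinf_on_continuous[OF c] JI continuous_on_subset by blast
  have c\<phi>: "continuous_on ?J \<phi>"
    unfolding continuous_on_def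
  proof
    fix y assume y: "y \<in> ?J"
    show "(\<phi> \<longlongrightarrow> \<phi> y) (at y within ?J)"
    proof (cases "y = s")
      case True
      have "((\<lambda>y. inverse (y - s) *\<^sub>R (c y - c s)) \<longlongrightarrow> d1 c s) (at s within ?J)"
        by (rule tendsto_difference_quotient[OF has_vector_derivative_at_within[OF Cinf_on_d1(2)[OF I c sI]]])
      moreover have "\<forall>\<^sub>F y in at s within ?J. inverse (y - s) *\<^sub>R (c y - c s) = \<phi> y"
        unfolding eventually_at_filter by (intro always_eventually) (simp add: \<phi>_def)
      ultimately have "(\<phi> \<longlongrightarrow> d1 c s) (at s within ?J)" by (rule Lim_transform_eventually)
      then show ?thesis using True by (simp add: \<phi>_def)
    next
      case False
      have "(c \<longlongrightarrow> c y) (at y within ?J)" using cc y by (simp add: continuous_on_def)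
      then have "((\<lambda>y. inverse (y - s) *\<^sub>R (c y - c s)) \<longlongrightarrow> inverse (y - s) *\<^sub>R (c y - c s)) (at y within ?J)"
        using False by (intro tendsto_intros) auto
      moreover have "\<forall>\<^sub>F z in at y within ?J. z \<noteq> s"
        using False tendsto_imp_eventually_ne[OF tendsto_ident_at] by blast
      then have "\<forall>\<^sub>F z in at y within ?J. inverse (z - s) *\<^sub>R (c z - c s) = \<phi> z"
        by eventually_elim (simp add: \<phi>_def)
      ultimately have "(\<phi> \<longlongrightarrow> inverse (y - s) *\<^sub>R (c y - c s)) (at y within ?J)" by (rule Lim_transform_eventually)
      then show ?thesis using False by (simp add: \<phi>_def)
    qed
  qed
  have "\<phi> y \<noteq> 0" if "y \<in> ?J" for y
    using that s unit[OF s] inj by (auto simp: \<phi>_def dest: inj_onD)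
  moreover obtain y0 where "y0 \<in> ?J" "\<forall>y\<in>?J. norm (\<phi> y0) \<le> norm (\<phi> y)"
    using continuous_attains_inf[OF compact_Jint, of l "\<lambda>y. norm (\<phi> y)"] c\<phi> s
    by (auto intro: continuous_on_norm)
  ultimately obtain m where m: "m > 0" "\<And>y. y \<in> ?J \<Longrightarrow> m \<le> norm (\<phi> y)"
    by (metis zero_less_norm_iff)
  define a where "a k = (t k - s) / v k" for k
  define b where "b k = w k / v k" for k
  have ab: "rul F s = a k *\<^sub>R \<phi> (t k) + max (b k) 0 *\<^sub>R rul F' (t k) + min (b k) 0 *\<^sub>R rul G' (t k)" for k
  proof -
    have "v k *\<^sub>R rul F s = (t k - s) *\<^sub>R \<phi> (t k) + max (w k) 0 *\<^sub>R rul F' (t k) + min (w k) 0 *\<^sub>R rul G' (t k)"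
      unfolding \<phi>[symmetric] using tw[of k] by (simp add: algebra_simps)
    from arg_cong[OF this, of "scaleR (inverse (v k))"]
    have "rul F s = (inverse (v k) * (t k - s)) *\<^sub>R \<phi> (t k) + (inverse (v k) * max (w k) 0) *\<^sub>R rul F' (t k)
        + (inverse (v k) * min (w k) 0) *\<^sub>R rul G' (t k)"
      using v0[of k] by (simp add: scaleR_add_right)
    moreover have "inverse (v k) * max (w k) 0 = max (b k) 0" "inverse (v k) * min (w k) 0 = min (b k) 0"
      using v0[of k] by (auto simp: b_def max_def min_def divide_inverse mult.commute zero_le_mult_iff mult_le_0_iff)
    ultimately show ?thesis by (simp add: a_def divide_inverse mult.commute)
  qed
  have bb: "\<bar>b k\<bar> \<le> 2" for k
    using w[of k] v0[of k] by (simp add: b_def abs_divide field_simps)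
  \<comment> \<open>5 = 1 + 2 + 2: the rulings are unit vectors and both parts of b k are at most 2
    in absolute value.\<close>
  have ba: "\<bar>a k\<bar> \<le> 5 / m" for k
  proof -
    have "norm (rul F s - max (b k) 0 *\<^sub>R rul F' (t k) - min (b k) 0 *\<^sub>R rul G' (t k))
        \<le> norm (rul F s) + norm (max (b k) 0 *\<^sub>R rul F' (t k)) + norm (min (b k) 0 *\<^sub>R rul G' (t k))"
      by (smt (verit) norm_triangle_ineq4)
    also have "\<dots> = 1 + \<bar>max (b k) 0\<bar> + \<bar>min (b k) 0\<bar>"
      using strip_along_norm_rul[OF F s] strip_along_norm_rul[OF F' t] strip_along_norm_rul[OF G' t] by simp
    also have "\<dots> \<le> 5" using bb[of k] by auto
    finally have "norm (a k *\<^sub>R \<phi> (t k)) \<le> 5" using ab[of k] by (simp add: algebra_simps)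
    then have "\<bar>a k\<bar> * norm (\<phi> (t k)) \<le> 5" by simp
    moreover have "\<bar>a k\<bar> * m \<le> \<bar>a k\<bar> * norm (\<phi> (t k))"
      using m(2)[OF t] by (intro mult_left_mono) auto
    ultimately show ?thesis using m(1) by (simp add: field_simps)
  qed
  have tlim: "t \<longlonglongrightarrow> s"
  proof -
    have "(\<lambda>k. t k - s) \<longlonglongrightarrow> 0"
    proof (rule Lim_null_comparison)
      show "\<forall>\<^sub>F k in sequentially. norm (t k - s) \<le> (5 / m) * v k"
      proof (intro always_eventually allI)
        show "norm (t k - s) \<le> (5 / m) * v k" for k
          using ba[of k] v0[of k] by (simp add: a_def abs_divide pos_divide_le_eq)
      qed
      show "(\<lambda>k. (5 / m) * v k) \<longlonglongrightarrow> 0"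
        using tendsto_mult_left[OF v_lim, of "5 / m"] by simp
    qed
    then show ?thesis by (simp add: LIM_zero_iff)
  qed
  \<comment> \<open>A convergent subsequence of the coefficients, together with t k tending to s,
    expresses the ruling of F at s through c'(s) and the rulings of F' and G' at s.\<close>
  have "bounded (range (\<lambda>k. (a k, b k)))"
  proof (rule boundedI)
    fix z assume "z \<in> range (\<lambda>k. (a k, b k))"
    then obtain k where "z = (a k, b k)" by blast
    then show "norm z \<le> 5 / m + 2"
      using norm_Pair_le[of "a k" "b k"] ba[of k] bb[of k] by simp
  qed
  then obtain z \<rho> where \<rho>: "strict_mono \<rho>" "((\<lambda>k. (a k, b k)) \<circ> \<rho>) \<longlonglongrightarrow> z"
    using bounded_imp_convergent_subsequence by blast
  obtain A B where z: "z = (A, B)" by (cases z)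
  have lims: "(\<lambda>k. a (\<rho> k)) \<longlonglongrightarrow> A" "(\<lambda>k. b (\<rho> k)) \<longlonglongrightarrow> B"
    using tendsto_fst[OF \<rho>(2)] tendsto_snd[OF \<rho>(2)] by (simp_all add: z o_def)
  have tr: "(\<lambda>k. t (\<rho> k)) \<longlonglongrightarrow> s"
    using LIMSEQ_subseq_LIMSEQ[OF tlim \<rho>(1)] by (simp add: o_def)
  have comp: "(\<lambda>k. f (t (\<rho> k))) \<longlonglongrightarrow> f s" if "continuous_on ?J f" for f :: "real \<Rightarrow> real^3"
    using continuous_on_tendsto_compose[OF that tr s] t by simp
  have "(\<lambda>k. a (\<rho> k) *\<^sub>R \<phi> (t (\<rho> k)) + max (b (\<rho> k)) 0 *\<^sub>R rul F' (t (\<rho> k)) + min (b (\<rho> k)) 0 *\<^sub>R rul G' (t (\<rho> k)))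
      \<longlonglongrightarrow> A *\<^sub>R \<phi> s + max B 0 *\<^sub>R rul F' s + min B 0 *\<^sub>R rul G' s"
    by (intro tendsto_intros lims comp c\<phi> strip_along_continuous_rul[OF F'] strip_along_continuous_rul[OF G'])
  then have "(\<lambda>k. rul F s) \<longlonglongrightarrow> A *\<^sub>R \<phi> s + max B 0 *\<^sub>R rul F' s + min B 0 *\<^sub>R rul G' s"
    by (simp only: ab[symmetric])
  then have lim: "rul F s = A *\<^sub>R d1 c s + max B 0 *\<^sub>R rul F' s + min B 0 *\<^sub>R rul G' s"
    by (simp add: LIMSEQ_const_iff \<phi>_def)
  note frame = strip_along_frame[OF l I JI c _ s]
  have em: "d1 c s \<bullet> d2 c s = 0" by (rule d1_orthogonal_d2[OF l I JI c unit s])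
  have "rul F s \<bullet> d2 c s = max B 0 * (rul F' s \<bullet> d2 c s) + min B 0 * (rul G' s \<bullet> d2 c s)"
    by (subst lim) (simp add: inner_add_left em)
  \<comment> \<open>All three rulings have positive c''-component, so B \<le> 0 would make the
    right-hand side nonpositive: the limit lies on the F' side.\<close>
  then have "B > 0"
    using frame(3)[OF F] frame(3)[OF F'] frame(3)[OF G']
    by (cases "B > 0") (auto simp: not_less zero_less_mult_iff)
  then have lim: "rul F s = A *\<^sub>R d1 c s + B *\<^sub>R rul F' s" using lim by simp
  \<comment> \<open>Adding a multiple of c' and scaling by B > 0 do not change the quotient that
    equals tan \<alpha>.\<close>
  show ?thesis
    unfolding frame(4)[OF F] frame(4)[OF F'] unfolding lim
    using \<open>B > 0\<close> by (simp add: inner_add_left em dot_cross_self)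
qed

section \<open>Reversing the parametrization\<close>

lemma uminus_image_Jint: "uminus ` Jint l = Jint l"
  by (simp add: Jint_def)

lemma d1_reflect:
  assumes "open I" "Cinf_on I f" "- s \<in> I"
  shows "d1 (\<lambda>s. f (- s)) s = - d1 f (- s)"
  unfolding d1_def[of "\<lambda>s. f (- s)"]
  by (rule vector_derivative_at[OF has_vector_derivative_reflect[OF Cinf_on_d1(2)[OF assms]]])

lemma d2_reflect:
  assumes "open I" "Cinf_on I f" "- s \<in> I"
  shows "d2 (\<lambda>s. f (- s)) s = d2 f (- s)"
proof -
  have "((\<lambda>s. - d1 f (- s)) has_vector_derivative - (- d2 f (- s))) (at s)"
    by (rule has_vector_derivative_minus[OF has_vector_derivative_reflect[OF Cinf_on_d2(2)[OF assms]]])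
  then have "((\<lambda>s. - d1 f (- s)) has_vector_derivative d2 f (- s)) (at s)" by simp
  then have "(d1 (\<lambda>s. f (- s)) has_vector_derivative d2 f (- s)) (at s)"
  proof (rule has_vector_derivative_transform_within_open[OF _ open_negations[OF assms(1)]])
    show "s \<in> uminus ` I" using assms(3) by (metis imageI minus_minus)
    show "- d1 f (- y) = d1 (\<lambda>s. f (- s)) y" if "y \<in> uminus ` I" for y
      using d1_reflect[OF assms(1,2), of y] that by auto
  qed
  then show ?thesis unfolding d2_eq_d1_d1 by (subst d1_def) (rule vector_derivative_at)
qed

text \<open>Only s is reversed: the half v \<ge> 0 stays the half v \<ge> 0, so a folding keeps its
  image. The tangent changes sign and the principal normal does not, hence the binormal and \<alpha>
  change sign.\<close>

definition reverse_strip :: "(real \<times> real \<Rightarrow> real^3) \<Rightarrow> real \<times> real \<Rightarrow> real^3" where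
  "reverse_strip F = (\<lambda>(s, v). F (- s, v))"

lemma base_reverse_strip: "base (reverse_strip F) = (\<lambda>s. base F (- s))"
  and rul_reverse_strip: "rul (reverse_strip F) = (\<lambda>s. rul F (- s))"
  by (simp_all add: base_def rul_def reverse_strip_def fun_eq_iff)

lemma strip_on_reverse_strip:
  assumes "strip_on l C F I \<delta>"
  shows "strip_on l C (reverse_strip F) (uminus ` I) \<delta>"
proof -
  note st = strip_onD[OF assms]
  have "ruled_on (uminus ` I) \<delta> (reverse_strip F)"
    unfolding ruled_on_def base_reverse_strip rul_reverse_strip
    using open_negations[OF st(1)] st(3) Cinf_on_reflect[OF st(1,4)] Cinf_on_reflect[OF st(1,5)] st(6)
    by (auto simp: reverse_strip_def)
  moreover have "Jint l \<subseteq> uminus ` I"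
    using image_mono[OF st(2), of uminus] by (simp add: uminus_image_Jint)
  moreover have "inj_on (\<lambda>s. base F (- s)) (uminus ` I)"
    using st(7) by (auto simp: inj_on_def)
  moreover have "norm (rul F (- s)) = 1 \<and> cross3 (d1 (\<lambda>s. base F (- s)) s) (rul F (- s)) \<noteq> 0 \<and>
      d1 (\<lambda>s. rul F (- s)) s \<bullet> cross3 (d1 (\<lambda>s. base F (- s)) s) (rul F (- s)) = 0"
    if "s \<in> uminus ` I" for s
  proof -
    have s: "- s \<in> I" using that by auto
    show ?thesis
      using st(8)[OF s] st(9)[OF s] st(10)[OF s] d1_reflect[OF st(1,4) s] d1_reflect[OF st(1,5) s] by simp
  qed
  moreover have "(\<lambda>s. base F (- s)) ` Jint l = C"
    using st(11) uminus_image_Jint[of l] by (metis image_image)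
  moreover have "norm (d1 (\<lambda>s. base F (- s)) s) = 1" if "s \<in> Jint l" for s
    using d1_reflect[OF st(1,4), of s] st(12)[of "- s"] st(13)[of "- s"] that by (simp add: uminus_mem_Jint)
  ultimately show ?thesis
    unfolding strip_on_def base_reverse_strip rul_reverse_strip by blast
qed

context
  fixes l C F I \<delta> s
  assumes st: "strip_on l C F I \<delta>" and s: "s \<in> Jint l"
begin

private lemma s': "- s \<in> I"
  using strip_onD(13)[OF st] s by (simp add: uminus_mem_Jint)

lemma curv_reverse_strip: "curv (base (reverse_strip F)) s = curv (base F) (- s)"
  unfolding curv_def base_reverse_strip d2_reflect[OF strip_onD(1,4)[OF st] s'] ..

private lemma pnormal_reverse_strip: "pnormal (base (reverse_strip F)) s = pnormal (base F) (- s)"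
  unfolding pnormal_def curv_reverse_strip unfolding base_reverse_strip d2_reflect[OF strip_onD(1,4)[OF st] s'] ..

private lemma binormal_reverse_strip: "binormal (base (reverse_strip F)) s = - binormal (base F) (- s)"
  unfolding binormal_def pnormal_reverse_strip tang_def
  unfolding base_reverse_strip d1_reflect[OF strip_onD(1,4)[OF st] s'] by simp

lemma angle1_reverse_strip: "angle1 (reverse_strip F) s = - angle1 F (- s)"
  unfolding angle1_def pnormal_reverse_strip binormal_reverse_strip
  by (simp add: rul_reverse_strip arctan_minus)

lemma normalized_reverse_strip_at:
  "normalized l F \<Longrightarrow> rul (reverse_strip F) s \<bullet> pnormal (base (reverse_strip F)) s > 0"
  unfolding pnormal_reverse_strip using s by (simp add: rul_reverse_strip normalized_def uminus_mem_Jint)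

end

lemma strip_along_reverse_strip:
  assumes "strip_on l C F I \<delta>" "normalized l F" "\<And>s. s \<in> Jint l \<Longrightarrow> base F s = c (- s)"
  shows "strip_along l c (reverse_strip F)"
  unfolding strip_along_def
proof (intro conjI ballI)
  show "\<exists>C I \<delta>. strip_on l C (reverse_strip F) I \<delta>"
    using strip_on_reverse_strip[OF assms(1)] by blast
  show "normalized l (reverse_strip F)"
    using normalized_reverse_strip_at[OF assms(1) _ assms(2)] by (simp add: normalized_def)
  show "base (reverse_strip F) s = c s" if "s \<in> Jint l" for s
    using assms(3)[of "- s"] that by (simp add: base_reverse_strip uminus_mem_Jint)
qed

lemma origami_image_reverse_strip:
  "origami_image l (reverse_strip F) (reverse_strip G) = origami_image l F G"
proof
  fix \<epsilon> :: real
  have "map_prod uminus id ` (Jint l \<times> {-\<epsilon><..<\<epsilon>}) = Jint l \<times> {-\<epsilon><..<\<epsilon>}"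
    by (simp add: map_prod_surj_on[OF uminus_image_Jint])
  then have "origami_image l F G \<epsilon>
      = (\<lambda>(s, v). if v \<ge> 0 then F (s, v) else G (s, v)) ` map_prod uminus id ` (Jint l \<times> {-\<epsilon><..<\<epsilon>})"
    by (simp add: origami_image_def)
  also have "\<dots> = origami_image l (reverse_strip F) (reverse_strip G) \<epsilon>"
    unfolding origami_image_def image_image by (rule image_cong) (auto simp: reverse_strip_def)
  finally show "origami_image l (reverse_strip F) (reverse_strip G) \<epsilon> = origami_image l F G \<epsilon>" ..
qed

text \<open>A map s -> \<sigma> s + d of \<open>Jint l\<close> into itself has d = 0, as its values
  at the two endpoints show. What is left of the equivalence is the direction of reading, encoded by
  b.\<close>

lemma generator_iff:
  assumes "l > 0"
  shows "generator l \<gamma> F \<longleftrightarrow> (\<exists>b. \<forall>s\<in>Jint l. mu F s = plane_curv \<gamma> (if b then s else - s))"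
proof
  assume "generator l \<gamma> F"
  then obtain \<sigma> d where \<sigma>: "\<sigma> \<in> {1, -1}"
    and d: "\<And>s. s \<in> Jint l \<Longrightarrow> \<sigma> * s + d \<in> Jint l \<and> mu F (\<sigma> * s + d) = plane_curv \<gamma> s"
    unfolding generator_def equi_affine_equiv_def by blast
  have "l/2 \<in> Jint l" "-l/2 \<in> Jint l" using assms by (auto simp: Jint_def)
  then have "d = 0" using d[of "l/2"] d[of "-l/2"] \<sigma> by (auto simp: Jint_def)
  then have mu: "mu F (\<sigma> * s) = plane_curv \<gamma> s" if "s \<in> Jint l" for s
    using d[OF that] by simp
  show "\<exists>b. \<forall>s\<in>Jint l. mu F s = plane_curv \<gamma> (if b then s else - s)"
  proof (intro exI[of _ "\<sigma> = 1"] ballI)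
    fix s assume "s \<in> Jint l"
    then show "mu F s = plane_curv \<gamma> (if \<sigma> = 1 then s else - s)"
      using mu[of s] mu[of "- s"] \<sigma> by (auto simp: uminus_mem_Jint)
  qed
next
  assume "\<exists>b. \<forall>s\<in>Jint l. mu F s = plane_curv \<gamma> (if b then s else - s)"
  then obtain b where b: "\<And>s. s \<in> Jint l \<Longrightarrow> mu F s = plane_curv \<gamma> (if b then s else - s)" by blast
  show "generator l \<gamma> F"
    unfolding generator_def equi_affine_equiv_def
    by (rule exI[of _ "if b then 1 else -1"], rule exI[of _ 0])
       (use b[of "- _"] b in \<open>auto simp: uminus_mem_Jint\<close>)
qed

section \<open>Counting the foldings\<close>

lemma strip_along_curv:
  assumes "l > 0" "open I" "Jint l \<subseteq> I" "Cinf_on I c" "strip_along l c H" "s \<in> Jint l"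
  shows "curv (base H) s = curv c s"
  using strip_along_frame(2)[OF assms] by (simp add: curv_def)

lemma strip_along_rul_unique:
  assumes l: "l > 0" and F: "strip_along l c F" and G: "strip_along l c G"
    and tan: "\<And>s. s \<in> Jint l \<Longrightarrow> tan (angle1 F s) = tan (angle1 G s)"
    and nz: "\<And>s. s \<in> Jint l \<Longrightarrow> tan (angle1 F s) \<noteq> 0" and s: "s \<in> Jint l"
  shows "rul F s = rul G s"
proof -
  obtain C I \<delta> where stF: "strip_on l C F I \<delta>" using F unfolding strip_along_def by blast
  obtain C' I' \<delta>' where stG: "strip_on l C' G I' \<delta>'" using G unfolding strip_along_def by blast
  have nF: "normalized l F" and nG: "normalized l G"
    using F G unfolding strip_along_def by auto
  show ?thesis
  proof (rule rul_unique[OF l stF nF stG nG _ _ s])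
    show "base F t = base G t" if "t \<in> Jint l" for t
      using F G that unfolding strip_along_def by simp
    show "angle1 F t = angle1 G t" if "t \<in> Jint l" for t
      using tan[OF that] by (simp add: angle1_eq_iff_tan)
    show "angle1 F s \<noteq> 0" using nz[OF s] by auto
  qed
qed

lemma Jint_constant_sign:
  assumes "continuous_on (Jint l) f" "\<And>s. s \<in> Jint l \<Longrightarrow> f s \<noteq> (0::real)"
  shows "(\<forall>s\<in>Jint l. f s > 0) \<or> (\<forall>s\<in>Jint l. f s < 0)"
proof (rule ccontr)
  assume "\<not> ?thesis"
  then obtain s t where st: "s \<in> Jint l" "t \<in> Jint l" "f s \<le> 0" "f t \<ge> 0" by fastforce
  have "connected (f ` Jint l)"
    by (rule connected_continuous_image[OF assms(1)]) (simp add: Jint_def)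
  then have "{f s..f t} \<subseteq> f ` Jint l"
    using connected_contains_Icc st by blast
  then have "0 \<in> f ` Jint l" using st by auto
  then show False using assms(2) by auto
qed

text \<open>The tangent of the first angular function \<open>\<alpha>\<close> with \<open>cos \<alpha> = m / k\<close>, up to its sign.\<close>

definition slope :: "bool \<Rightarrow> real \<Rightarrow> real \<Rightarrow> real" where
  "slope p k m = (if p then 1 else -1) * sqrt ((k / m)\<^sup>2 - 1)"

lemma one_less_square_divide:
  assumes "0 < m" "m < k"
  shows "(k / m)\<^sup>2 > (1::real)"
  using assms by (simp add: one_less_power)

lemma slope_nonzero:
  assumes "0 < m" "m < k"
  shows "slope p k m \<noteq> 0"
  using one_less_square_divide[OF assms] by (simp add: slope_def)

lemma slope_not: "slope (\<not> p) k m = - slope p k m"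
  by (simp add: slope_def)

lemma slope_eq_iff:
  assumes "0 < m" "m < k" "0 < m'" "m' < k"
  shows "slope p k m = slope p' k m' \<longleftrightarrow> p = p' \<and> m = m'"
proof
  assume eq: "slope p k m = slope p' k m'"
  have pos: "sqrt ((k / m)\<^sup>2 - 1) > 0" "sqrt ((k / m')\<^sup>2 - 1) > 0"
    using one_less_square_divide assms by auto
  have "p = p' \<and> x = y"
    if "(if p then 1 else -1) * x = (if p' then 1 else -1) * y" "x > 0" "y > 0" for x y :: real
    using that by (auto split: if_splits)
  from this[OF eq[unfolded slope_def] pos]
  have pp: "p = p'" and "sqrt ((k / m)\<^sup>2 - 1) = sqrt ((k / m')\<^sup>2 - 1)" by auto
  then have "(k / m)\<^sup>2 = (k / m')\<^sup>2" by simp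
  then have "k / m = k / m'"
    using assms by (simp add: power2_eq_iff_nonneg)
  then show "p = p' \<and> m = m'" using pp assms by (simp add: field_simps)
qed simp

lemma tan_eq_slope:
  assumes "0 < cos x" "k > 0" "k * cos x = m"
  shows "tan x = slope (tan x > 0) k m \<or> tan x = 0"
proof -
  have "k / m = inverse (cos x)" using assms by (auto simp: field_simps)
  then have "(k / m)\<^sup>2 = 1 + (tan x)\<^sup>2" using tan_sec[of x] assms(1) by simp
  then have "sqrt ((k / m)\<^sup>2 - 1) = \<bar>tan x\<bar>" by simp
  then show ?thesis by (auto simp: slope_def)
qed

lemma cos_angle1_pos: "cos (angle1 F s) > 0"
  using angle1_bounds[of F s] by (intro cos_gt_zero_pi) auto

lemma cos_angle1_of_slope:
  assumes "tan (angle1 F s) = slope p k m" "0 < m" "m < k"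
  shows "cos (angle1 F s) = m / k"
proof -
  note pos = cos_angle1_pos[of F s]
  have "(tan (angle1 F s))\<^sup>2 = (k / m)\<^sup>2 - 1"
    using one_less_square_divide[OF assms(2,3)] by (simp add: assms(1) slope_def)
  then have "(inverse (cos (angle1 F s)))\<^sup>2 = (k / m)\<^sup>2"
    using tan_sec[of "angle1 F s"] pos by simp
  then have "inverse (cos (angle1 F s)) = k / m"
    using pos assms(2,3) by (simp add: power2_eq_iff_nonneg)
  then show ?thesis by (metis inverse_divide inverse_inverse_eq)
qed

lemma slope_smooth:
  fixes f :: "real \<Rightarrow> 'a::real_inner" and g :: "real \<Rightarrow> 'b::real_inner"
  assumes I: "open I" and JI: "Jint l \<subseteq> I" and f: "Cinf_on I f" and g: "Cinf_on I g"
    and bnd: "\<And>s. s \<in> Jint l \<Longrightarrow> 0 < norm (g s) \<and> norm (g s) < norm (f s)"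
  obtains I0 where "open I0" "Jint l \<subseteq> I0" "I0 \<subseteq> I" "Cinf_on I0 (\<lambda>s. slope p (norm (f s)) (norm (g s)))"
proof
  \<comment> \<open>Positivity of h combines both strict inequalities into one open condition. Where
    it holds, the norms are smooth and the radicand is positive.\<close>
  define h where "h s = min (norm (g s)) (norm (f s) - norm (g s))" for s
  define I0 where "I0 = {s \<in> I. 0 < h s}"
  have "continuous_on I h"
    unfolding h_def by (intro continuous_intros Cinf_on_continuous[OF f] Cinf_on_continuous[OF g])
  then show I0: "open I0"
    using continuous_open_preimage[OF _ I, of h "{0<..}"] by (auto simp: I0_def vimage_def Int_def)
  show "Jint l \<subseteq> I0" using JI bnd by (auto simp: I0_def h_def)
  show sub: "I0 \<subseteq> I" by (auto simp: I0_def)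
  have b: "0 < norm (g s)" "norm (g s) < norm (f s)" if "s \<in> I0" for s
    using that by (auto simp: I0_def h_def)
  have nz: "f s \<noteq> 0" "g s \<noteq> 0" if "s \<in> I0" for s
    using b[OF that] by auto
  have q: "Cinf_on I0 (\<lambda>s. norm (f s) / norm (g s))"
    by (intro Cinf_on_divide Cinf_on_norm I0 Cinf_on_subset[OF f sub] Cinf_on_subset[OF g sub])
       (use nz in auto)
  have "Cinf_on I0 (\<lambda>s. (if p then 1 else -1) * sqrt ((norm (f s) / norm (g s)) * (norm (f s) / norm (g s)) - 1))"
    by (intro Cinf_on_mult Cinf_on_sqrt Cinf_on_diff Cinf_on_const I0 q)
       (use one_less_square_divide b in \<open>simp add: power2_eq_square\<close>)
  then show "Cinf_on I0 (\<lambda>s. slope p (norm (f s)) (norm (g s)))"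
    by (simp add: slope_def power2_eq_square)
qed

section \<open>Foldings along the fixed crease \<open>c\<close>\<close>

context
  fixes l :: real and c :: "real \<Rightarrow> real^3" and \<gamma> :: "real \<Rightarrow> real^2" and I I' :: "real set"
  assumes l: "l > 0"
    and I: "open I" and JI: "Jint l \<subseteq> I" and c: "Cinf_on I c"
    and unit: "\<And>s. s \<in> Jint l \<Longrightarrow> norm (d1 c s) = 1" and inj: "inj_on c (Jint l)"
    and curv: "\<And>s. s \<in> Jint l \<Longrightarrow> curv c s \<noteq> 0"
    and I': "open I'" and JI': "Jint l \<subseteq> I'" and \<gamma>: "Cinf_on I' \<gamma>"
begin

private lemma curv_pos: "s \<in> Jint l \<Longrightarrow> curv c s > 0"
  using curv[of s] by (simp add: curv_def)

private lemma INF_curv_le: "s \<in> Jint l \<Longrightarrow> (INF w\<in>Jint l. curv c w) \<le> curv c s"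
  by (rule cINF_lower[OF bdd_belowI2[of _ 0]]) (simp add: curv_def)

text \<open>The crease of F is c or its reversal. In the second case both F and its dual are
  reversed, which keeps the folded image and the duality of the angles and exchanges the two
  directions of reading.\<close>

lemma Pstar_representative:
  assumes F: "normal_form l (c ` Jint l) F" and D: "in_Dstar l F" and gen: "generator l \<gamma> F"
    and G: "is_dual l (c ` Jint l) F G"
  obtains F' G' b where "strip_along l c F'" "strip_along l c G'"
    "germ (origami_image l F G) = germ (origami_image l F' G')"
    "\<forall>s\<in>Jint l. angle1 G' s = - angle1 F' s"
    "\<forall>s\<in>Jint l. curv c s * cos (angle1 F' s) = plane_curv \<gamma> (if b then s else - s)"
    "\<forall>s\<in>Jint l. cos (angle1 F' s) < 1"
    "\<forall>s\<in>Jint l. plane_curv \<gamma> s < (INF w\<in>Jint l. curv c w)"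
proof -
  obtain IF \<delta>F where stF: "strip_on l (c ` Jint l) F IF \<delta>F" using normal_form_strip_on[OF F] .
  have nG: "normal_form l (c ` Jint l) G" "normalized l G"
    and bG: "\<And>s. s \<in> Jint l \<Longrightarrow> base G s = base F s"
    and aG: "\<And>s. s \<in> Jint l \<Longrightarrow> angle1 G s = - angle1 F s"
    using G by (auto simp: is_dual_def base_def)
  obtain IG \<delta>G where stG: "strip_on l (c ` Jint l) G IG \<delta>G" using normal_form_strip_on[OF nG(1)] .
  have nF: "normalized l F" and cosF: "\<And>s. s \<in> Jint l \<Longrightarrow> cos (angle1 F s) < 1"
    and muF: "\<And>s. s \<in> Jint l \<Longrightarrow> mu F s < (INF w\<in>Jint l. curv (base F) w)"
    using D by (auto simp: in_Dstar_def)
  obtain b where b: "\<And>s. s \<in> Jint l \<Longrightarrow> mu F s = plane_curv \<gamma> (if b then s else - s)"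
    using gen generator_iff[OF l] by blast
  \<comment> \<open>Admissibility bounds \<open>mu F\<close> at s and at -s by the same number, so
    the bound passes to \<gamma> whichever direction b prescribes.\<close>
  have bound: "plane_curv \<gamma> s < (INF w\<in>Jint l. curv (base F) w)" if "s \<in> Jint l" for s
    using b[of s] b[of "- s"] muF[of s] muF[of "- s"] that by (cases b) (auto simp: uminus_mem_Jint)
  have "(\<forall>s\<in>Jint l. base F s = c s) \<or> (\<forall>s\<in>Jint l. base F s = c (- s))"
  proof (rule unit_speed_same_image[OF l])
    show "(base F has_vector_derivative d1 (base F) s) (at s within Jint l)" if "s \<in> Jint l" for s
      using Cinf_on_d1(2)[OF strip_onD(1,4)[OF stF] strip_onD(13)[OF stF that]]
      by (rule has_vector_derivative_at_within)
    show "(c has_vector_derivative d1 c s) (at s within Jint l)" if "s \<in> Jint l" for s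
      using Cinf_on_d1(2)[OF I c] JI that by (blast intro: has_vector_derivative_at_within)
    show "inj_on (base F) (Jint l)"
      using strip_onD(2,7)[OF stF] by (blast intro: inj_on_subset)
  qed (use unit inj strip_onD(11,12)[OF stF] in auto)
  then show thesis
  proof
    assume base: "\<forall>s\<in>Jint l. base F s = c s"
    have F': "strip_along l c F" and G': "strip_along l c G"
      using stF stG nF nG(2) base bG unfolding strip_along_def by auto
    have cv: "curv (base F) s = curv c s" if "s \<in> Jint l" for s
      using strip_along_curv[OF l I JI c F' that] .
    show thesis
    proof (rule that[OF F' G' refl])
      show "\<forall>s\<in>Jint l. curv c s * cos (angle1 F s) = plane_curv \<gamma> (if b then s else - s)"
        using b cv by (simp add: mu_def)
      show "\<forall>s\<in>Jint l. plane_curv \<gamma> s < (INF w\<in>Jint l. curv c w)"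
        using bound cv by (simp cong: INF_cong)
    qed (use aG cosF in auto)
  next
    assume base: "\<forall>s\<in>Jint l. base F s = c (- s)"
    let ?F = "reverse_strip F" and ?G = "reverse_strip G"
    have F': "strip_along l c ?F" and G': "strip_along l c ?G"
      using strip_along_reverse_strip[OF stF nF, of c] strip_along_reverse_strip[OF stG nG(2), of c] base bG by auto
    have cv: "curv (base F) (- s) = curv c s" if "s \<in> Jint l" for s
      using strip_along_curv[OF l I JI c F' that] curv_reverse_strip[OF stF that] by simp
    show thesis
    proof (rule that[OF F' G'])
      show "germ (origami_image l F G) = germ (origami_image l ?F ?G)"
        by (simp add: origami_image_reverse_strip)
      show "\<forall>s\<in>Jint l. angle1 ?G s = - angle1 ?F s"
        using angle1_reverse_strip[OF stF] angle1_reverse_strip[OF stG] aG by (simp add: uminus_mem_Jint)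
      show "\<forall>s\<in>Jint l. curv c s * cos (angle1 ?F s) = plane_curv \<gamma> (if \<not> b then s else - s)"
        using b[of "- _"] cv angle1_reverse_strip[OF stF] by (auto simp: mu_def uminus_mem_Jint)
      show "\<forall>s\<in>Jint l. cos (angle1 ?F s) < 1"
        using angle1_reverse_strip[OF stF] cosF by (simp add: uminus_mem_Jint)
      have "curv (base F) ` Jint l = curv c ` Jint l"
        using cv uminus_image_Jint[of l] by (metis (no_types, lifting) image_cong image_image)
      then show "\<forall>s\<in>Jint l. plane_curv \<gamma> s < (INF w\<in>Jint l. curv c w)"
        using bound by simp
    qed
  qed
qed

context
  assumes pos: "\<And>s. s \<in> Jint l \<Longrightarrow> 0 < plane_curv \<gamma> s"
    and bound: "\<And>s. s \<in> Jint l \<Longrightarrow> plane_curv \<gamma> s < (INF w\<in>Jint l. curv c w)"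
begin

private abbreviation crease_curv :: "bool \<Rightarrow> real \<Rightarrow> real" where
  "crease_curv b s \<equiv> plane_curv \<gamma> (if b then s else - s)"

private lemma crease_curv_bounds:
  assumes "s \<in> Jint l"
  shows "0 < crease_curv b s" "crease_curv b s < (INF w\<in>Jint l. curv c w)" "crease_curv b s < curv c s"
  using pos[of s] pos[of "- s"] bound[of s] bound[of "- s"] INF_curv_le[OF assms] assms
  by (auto simp: uminus_mem_Jint)

lemma strip_with_slope_exists:
  obtains F where "normal_form l (c ` Jint l) F" "strip_along l c F"
    "\<And>s. s \<in> Jint l \<Longrightarrow> tan (angle1 F s) = slope p (curv c s) (crease_curv b s)"
proof -
  \<comment> \<open>The curvature of the crease pattern is presented as the norm of a smooth vector
    function, since norms are smooth only where the vector does not vanish; reading backwards also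
    reflects the neighbourhood.\<close>
  define g where "g s = d2 \<gamma> (if b then s else - s)" for s
  define Ig where "Ig = (if b then I' else uminus ` I')"
  have Ig: "open Ig" using I' open_negations[OF I'] by (simp add: Ig_def)
  have JIg: "Jint l \<subseteq> Ig"
    using JI' image_mono[OF JI', of uminus] by (simp add: Ig_def uminus_image_Jint)
  have g: "Cinf_on Ig g"
    using Cinf_on_d2(1)[OF I' \<gamma>] Cinf_on_reflect[OF I' Cinf_on_d2(1)[OF I' \<gamma>]]
    by (cases b) (simp_all add: g_def[abs_def] Ig_def)
  have ng: "norm (g s) = crease_curv b s" for s by (simp add: g_def plane_curv_def)
  obtain I0 where I0: "open I0" "Jint l \<subseteq> I0" "I0 \<subseteq> I \<inter> Ig"
    and sm: "Cinf_on I0 (\<lambda>s. slope p (norm (d2 c s)) (norm (g s)))"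
  proof (rule slope_smooth[of "I \<inter> Ig" l "d2 c" g])
    show "open (I \<inter> Ig)" "Jint l \<subseteq> I \<inter> Ig" using I Ig JI JIg by auto
    show "Cinf_on (I \<inter> Ig) (d2 c)" "Cinf_on (I \<inter> Ig) g"
      using Cinf_on_subset[OF Cinf_on_d2(1)[OF I c]] Cinf_on_subset[OF g] by auto
    show "0 < norm (g s) \<and> norm (g s) < norm (d2 c s)" if "s \<in> Jint l" for s
      using crease_curv_bounds[OF that, of b] unfolding ng by (simp add: curv_def)
  qed
  have smooth: "Cinf_on I0 (\<lambda>s. slope p (curv c s) (crease_curv b s))"
    using sm unfolding ng curv_def .
  have cI0: "Cinf_on I0 c" using Cinf_on_subset[OF c] I0(3) by blast
  have nz: "slope p (curv c s) (crease_curv b s) \<noteq> 0" if "s \<in> Jint l" for s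
    using slope_nonzero crease_curv_bounds[OF that, of b] by blast
  have ex: "\<exists>F. normal_form l (c ` Jint l) F \<and> normalized l F \<and> (\<forall>s\<in>Jint l. base F s = c s) \<and>
      (\<forall>s\<in>Jint l. tan (angle1 F s) = slope p (curv c s) (crease_curv b s))"
    by (rule strip_exists[OF l I0(1,2) cI0 unit inj curv smooth nz])
  obtain F where F: "normal_form l (c ` Jint l) F" "normalized l F"
    and base: "\<forall>s\<in>Jint l. base F s = c s"
    and tan: "\<forall>s\<in>Jint l. tan (angle1 F s) = slope p (curv c s) (crease_curv b s)"
    using ex by blast
  obtain I1 \<delta> where "strip_on l (c ` Jint l) F I1 \<delta>"
    using normal_form_strip_on[OF F(1)] .
  then have "strip_along l c F"
    using F(2) base unfolding strip_along_def by blast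
  then show thesis using that F(1) tan by blast
qed

text \<open>The slope encodes cos \<alpha> = m / k, which makes \<open>mu F\<close> equal to m: the
  generator condition is then immediate and admissibility is the uniform bound. Opposite slopes mean
  opposite angles because both lie in the range of arctan.\<close>

lemma folding_in_Pstar:
  assumes F: "normal_form l (c ` Jint l) F" "strip_along l c F"
      "\<And>s. s \<in> Jint l \<Longrightarrow> tan (angle1 F s) = slope p (curv c s) (crease_curv b s)"
    and G: "normal_form l (c ` Jint l) G" "strip_along l c G"
      "\<And>s. s \<in> Jint l \<Longrightarrow> tan (angle1 G s) = slope (\<not> p) (curv c s) (crease_curv b s)"
  shows "germ (origami_image l F G) \<in> Pstar l \<gamma> (c ` Jint l)"
proof -
  have cos: "cos (angle1 F s) = crease_curv b s / curv c s" if "s \<in> Jint l" for s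
    using cos_angle1_of_slope[OF F(3)[OF that]] crease_curv_bounds[OF that] by blast
  have cv: "curv (base F) s = curv c s" if "s \<in> Jint l" for s
    using strip_along_curv[OF l I JI c F(2) that] .
  have mu: "mu F s = crease_curv b s" if "s \<in> Jint l" for s
    using cos[OF that] cv[OF that] curv[OF that] by (simp add: mu_def)
  have "in_Dstar l F"
    unfolding in_Dstar_def
  proof (intro conjI ballI)
    show "normalized l F" using F(2) by (simp add: strip_along_def)
    fix s assume s: "s \<in> Jint l"
    show "0 < \<bar>cos (angle1 F s)\<bar>" using cos_angle1_pos[of F s] by simp
    show "\<bar>cos (angle1 F s)\<bar> < 1"
      using crease_curv_bounds[OF s, of b] by (simp add: cos[OF s])
    show "mu F s < (INF w\<in>Jint l. curv (base F) w)"
      using crease_curv_bounds(2)[OF s, of b] cv by (simp add: mu[OF s] cong: INF_cong)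
  qed
  moreover have "generator l \<gamma> F" using mu generator_iff[OF l] by blast
  moreover have "is_dual l (c ` Jint l) F G"
    unfolding is_dual_def
  proof (intro conjI ballI)
    show "normalized l G" using G(2) by (simp add: strip_along_def)
    fix s assume s: "s \<in> Jint l"
    show "G (s, 0) = F (s, 0)" using F(2) G(2) s by (simp add: strip_along_def base_def)
    have "tan (angle1 G s) = tan (- angle1 F s)"
      by (simp add: F(3)[OF s] G(3)[OF s] slope_not)
    then show "angle1 G s = - angle1 F s"
      using arctan_tan[of "angle1 G s"] arctan_tan[of "- angle1 F s"] angle1_bounds[of F s] angle1_bounds[of G s] by simp
  qed (rule G(1))
  ultimately show ?thesis unfolding Pstar_def using F(1) by blast
qed

text \<open>The cosine gives |tan \<alpha>| at each point. Because cos \<alpha> < 1, the continuous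
  function tan \<alpha> has no zero, so a single sign p serves on all of
  \<open>Jint l\<close>.\<close>

lemma strip_slope_sign:
  assumes F: "strip_along l c F" and lt: "\<forall>s\<in>Jint l. cos (angle1 F s) < 1"
    and m: "\<forall>s\<in>Jint l. curv c s * cos (angle1 F s) = m s"
  obtains p where "\<forall>s\<in>Jint l. tan (angle1 F s) = slope p (curv c s) (m s)"
proof -
  have nz: "tan (angle1 F s) \<noteq> 0" if "s \<in> Jint l" for s
  proof
    assume "tan (angle1 F s) = 0"
    then have "angle1 F s = 0"
      using arctan_tan[of "angle1 F s"] angle1_bounds[of F s] by simp
    then show False using lt that by force
  qed
  have eq: "tan (angle1 F s) = slope (tan (angle1 F s) > 0) (curv c s) (m s)" if "s \<in> Jint l" for s
    using tan_eq_slope[OF cos_angle1_pos curv_pos[OF that]] m nz[OF that] that by blast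
  have "continuous_on (Jint l) (\<lambda>s. tan (angle1 F s))"
  proof (rule continuous_on_eq)
    have 1: "continuous_on (Jint l) (d1 c)" "continuous_on (Jint l) (d2 c)"
      using Cinf_on_continuous[OF Cinf_on_d1(1)[OF I c]] Cinf_on_continuous[OF Cinf_on_d2(1)[OF I c]] JI
      by (auto intro: continuous_on_subset)
    show "continuous_on (Jint l) (\<lambda>s. (rul F s \<bullet> cross3 (d1 c s) (d2 c s)) / (rul F s \<bullet> d2 c s))"
      by (intro continuous_on_divide continuous_on_inner continuous_on_cross 1 strip_along_continuous_rul[OF F])
         (use strip_along_frame(3)[OF l I JI c F] in force)
  qed (use strip_along_frame(4)[OF l I JI c F] in simp)
  from Jint_constant_sign[OF this nz] show thesis
    using that[of True] that[of False] eq by (metis less_asym)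
qed

text \<open>The four foldings are indexed by the direction in which the crease pattern is
  traversed and by the sign of the first angular function.\<close>

lemma Pstar_parametrization:
  "\<exists>E. Pstar l \<gamma> (c ` Jint l) = {E True True, E True False, E False True, E False False} \<and>
    (\<forall>b p b' p'. E b p = E b' p' \<longleftrightarrow> p = p' \<and> (\<forall>s\<in>Jint l. crease_curv b s = crease_curv b' s))"
proof -
  have "\<forall>b p. \<exists>F. normal_form l (c ` Jint l) F \<and> strip_along l c F \<and>
      (\<forall>s\<in>Jint l. tan (angle1 F s) = slope p (curv c s) (crease_curv b s))"
    using strip_with_slope_exists by metis
  then obtain F where F: "\<And>b p. normal_form l (c ` Jint l) (F b p)" "\<And>b p. strip_along l c (F b p)"
    "\<And>b p s. s \<in> Jint l \<Longrightarrow> tan (angle1 (F b p) s) = slope p (curv c s) (crease_curv b s)"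
    by metis
  \<comment> \<open>The dual half has the same geodesic curvature and the opposite angle, hence the
    same b and the negated p.\<close>
  define E where "E b p = germ (origami_image l (F b p) (F b (\<not> p)))" for b p
  have unique: "germ (origami_image l F' G') = E b p"
    if F': "strip_along l c F'" and G': "strip_along l c G'"
      and tF: "\<And>s. s \<in> Jint l \<Longrightarrow> tan (angle1 F' s) = slope p (curv c s) (crease_curv b s)"
      and tG: "\<And>s. s \<in> Jint l \<Longrightarrow> tan (angle1 G' s) = slope (\<not> p) (curv c s) (crease_curv b s)"
    for F' G' b p
    unfolding E_def
  proof (rule germ_origami_cong[OF F' F(2) _ G' F(2)])
    show "rul F' s = rul (F b p) s" if "s \<in> Jint l" for s
      by (rule strip_along_rul_unique[OF l F' F(2) _ _ that])
         (use tF F(3) slope_nonzero crease_curv_bounds in simp_all)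
    show "rul G' s = rul (F b (\<not> p)) s" if "s \<in> Jint l" for s
      by (rule strip_along_rul_unique[OF l G' F(2) _ _ that])
         (use tG F(3) slope_nonzero crease_curv_bounds in simp_all)
  qed
  have inE: "E b p \<in> Pstar l \<gamma> (c ` Jint l)" for b p
    unfolding E_def by (rule folding_in_Pstar[OF F(1,2,3) F(1,2,3)])
  have "e \<in> {E True True, E True False, E False True, E False False}" if e_in: "e \<in> Pstar l \<gamma> (c ` Jint l)" for e
  proof -
    obtain F0 G0 where e: "e = germ (origami_image l F0 G0)"
      and FG: "normal_form l (c ` Jint l) F0" "in_Dstar l F0" "generator l \<gamma> F0" "is_dual l (c ` Jint l) F0 G0"
      using e_in unfolding Pstar_def by blast
    obtain F' G' b where F'G': "strip_along l c F'" "strip_along l c G'"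
      and eq: "germ (origami_image l F0 G0) = germ (origami_image l F' G')"
      and ang: "\<forall>s\<in>Jint l. angle1 G' s = - angle1 F' s"
      and cos: "\<forall>s\<in>Jint l. curv c s * cos (angle1 F' s) = crease_curv b s"
      and lt: "\<forall>s\<in>Jint l. cos (angle1 F' s) < 1"
      using Pstar_representative[OF FG] by metis
    obtain p where p: "\<forall>s\<in>Jint l. tan (angle1 F' s) = slope p (curv c s) (crease_curv b s)"
      using strip_slope_sign[OF F'G'(1) lt cos] .
    have "germ (origami_image l F' G') = E b p"
      by (rule unique[OF F'G']) (use p ang in \<open>simp_all add: slope_not\<close>)
    then show ?thesis using e eq by (cases b; cases p) simp_all
  qed
  then have "Pstar l \<gamma> (c ` Jint l) = {E True True, E True False, E False True, E False False}"
    using inE by blast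
  moreover have "E b p = E b' p' \<longleftrightarrow> p = p' \<and> (\<forall>s\<in>Jint l. crease_curv b s = crease_curv b' s)" for b p b' p'
  proof
    assume "E b p = E b' p'"
    then have "slope p (curv c s) (crease_curv b s) = slope p' (curv c s) (crease_curv b' s)"
      if "s \<in> Jint l" for s
      using germ_eq_imp_tan_angle1_eq[OF l I JI c unit inj F(2) F(2) F(2) _ that] F(3)[OF that]
      unfolding E_def by metis
    then have "p = p' \<and> crease_curv b s = crease_curv b' s" if "s \<in> Jint l" for s
      using slope_eq_iff[OF crease_curv_bounds(1,3)[OF that, of b] crease_curv_bounds(1,3)[OF that, of b'], of p p'] that
      by blast
    \<comment> \<open>Some point of \<open>Jint l\<close> is needed to extract p = p', which does
      not depend on s.\<close>
    moreover have "0 \<in> Jint l" using l by (simp add: Jint_def)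
    ultimately show "p = p' \<and> (\<forall>s\<in>Jint l. crease_curv b s = crease_curv b' s)" by blast
  next
    assume eq: "p = p' \<and> (\<forall>s\<in>Jint l. crease_curv b s = crease_curv b' s)"
    show "E b p = E b' p'"
      unfolding E_def[of b p]
      by (rule unique[OF F(2) F(2)]) (use F(3) eq in auto)
  qed
  ultimately show ?thesis by blast
qed

end

end

theorem theoremA:
  fixes l :: real and c :: "real \<Rightarrow> real^3" and \<gamma> :: "real \<Rightarrow> real^2"
    and C :: "(real^3) set" and \<Gamma> :: "(real^2) set" and I I' :: "real set"
  assumes "l > 0"
    and "open I" "Jint l \<subseteq> I" "Cinf_on I c"
    and "\<forall>s\<in>Jint l. norm (d1 c s) = 1"
    and "inj_on c (Jint l)"
    and "\<forall>s\<in>Jint l. curv c s \<noteq> 0"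
    and "C = c ` Jint l"
    and "open I'" "Jint l \<subseteq> I'" "Cinf_on I' \<gamma>"
    and "\<forall>s\<in>Jint l. norm (d1 \<gamma> s) = 1"
    and "inj_on \<gamma> (Jint l)"
    and "\<Gamma> = \<gamma> ` Jint l"
    and "Pstar l \<gamma> C \<noteq> {}"
  shows "card (Pstar l \<gamma> C) = (if has_symmetry \<Gamma> then 2 else 4)"
proof -
  note crease = assms(1-4) assms(5)[rule_format] assms(6) assms(7)[rule_format] assms(9-11)
  obtain F0 G0 where FG: "normal_form l (c ` Jint l) F0" "in_Dstar l F0" "generator l \<gamma> F0"
    "is_dual l (c ` Jint l) F0 G0"
    using assms(8,15) unfolding Pstar_def by blast
  obtain F b where cos: "\<forall>s\<in>Jint l. curv c s * cos (angle1 F s) = plane_curv \<gamma> (if b then s else - s)"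
    and bound: "\<forall>s\<in>Jint l. plane_curv \<gamma> s < (INF w\<in>Jint l. curv c w)"
    using Pstar_representative[OF crease FG] by metis
  have curv_pos: "0 < curv c s * cos (angle1 F s)" if "s \<in> Jint l" for s
    using assms(7) that cos_angle1_pos[of F s] by (intro mult_pos_pos) (auto simp: curv_def)
  have pos: "0 < plane_curv \<gamma> s" if "s \<in> Jint l" for s
    using cos curv_pos[of s] curv_pos[of "- s"] that by (cases b) (force simp: uminus_mem_Jint)+
  have "\<exists>E. Pstar l \<gamma> C = {E True True, E True False, E False True, E False False} \<and>
     (\<forall>b p b' p'. E b p = E b' p' \<longleftrightarrow> p = p' \<and>
       (\<forall>s\<in>Jint l. plane_curv \<gamma> (if b then s else - s) = plane_curv \<gamma> (if b' then s else - s)))"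
    unfolding assms(8) by (rule Pstar_parametrization[OF crease pos bound[rule_format]])
  then obtain E where PE: "Pstar l \<gamma> C = {E True True, E True False, E False True, E False False} \<and>
     (\<forall>b p b' p'. E b p = E b' p' \<longleftrightarrow> p = p' \<and>
       (\<forall>s\<in>Jint l. plane_curv \<gamma> (if b then s else - s) = plane_curv \<gamma> (if b' then s else - s)))" ..
  note P = PE[THEN conjunct1] and E = PE[THEN conjunct2, THEN spec, THEN spec, THEN spec, THEN spec]
  note sym = has_symmetry_imp_curv_even[OF assms(1,9-11) assms(12)[rule_format] assms(13) pos]
    curv_even_imp_has_symmetry[OF assms(1,9-11) assms(12)[rule_format] assms(13) pos]
  show ?thesis
  proof (cases "has_symmetry \<Gamma>")
    case True
    then have "plane_curv \<gamma> (- s) = plane_curv \<gamma> s" if "s \<in> Jint l" for s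
      using sym(1) that assms(14) by blast
    \<comment> \<open>An even curvature makes the direction of reading immaterial; the sign of
      \<alpha> still separates two elements.\<close>
    then have "E False p = E True p" for p by (simp add: E)
    then have "Pstar l \<gamma> C = {E True True, E True False}" unfolding P by auto
    moreover have "E True True \<noteq> E True False" by (simp add: E)
    ultimately show ?thesis using True by simp
  next
    case False
    then obtain s where "s \<in> Jint l" "plane_curv \<gamma> (- s) \<noteq> plane_curv \<gamma> s"
      using sym(2) assms(14) by blast
    then have "E True p \<noteq> E False p'" for p p' unfolding E by auto
    moreover have "E b True \<noteq> E b False" for b by (simp add: E)
    ultimately show ?thesis using False unfolding P by (simp add: eq_commute)
  qed
qed

end
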